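(* Let $(\Gamma,\mu)$ be a weighted graph satisfying condition $(p_0)$. 1. If $(\overline{E})$ holds, then there are constants $q,c,C>0$ such that, with $k(x,n,R)$ defined using this $q$, for all $n\ge R>0$ and all $x\in\Gamma$, $$\mathbb{P}_x\left(T_{x,R}<n\right)\le C\exp\left(-c\,k(x,n,R)\right).$$ 2. If $(\Gamma,\mu)$ satisfies the elliptic Harnack inequality $(H)$, then there are constants $Q,c,C>0$ such that, with $\nu(x,n,R)$ defined using this $Q$, for all $n\ge R>0$ and all $x\in\Gamma$, $$\mathbb{P}_x\left(T_{x,R}<n\right)\ge c\exp\left(-C\,\nu(x,n,R)\right).$$
   Context: $\Gamma$ is an infinite connected graph without loops or multiple edges; $x\sim y$ denotes adjacency. A symmetric weight $\mu_{x,y}=\mu_{y,x}>0$ is given on the edges; $\mu(x)=\sum_{y\sim x}\mu_{x,y}$. $(X_n)$ is the random walk (Markov chain) on $\Gamma$ with transition probabilities $P(x,y)=\mu_{x,y}/\mu(x)$ for $x\sim y$ and $0$ otherwise; $\mathbb{P}_x,\mathbb{E}_x$ are probability and expectation for $X_0=x$. Condition $(p_0)$: there is $p_0>0$ with $P(x,y)\ge p_0$ for all $x\sim y$. $d$ is the shortest-path graph distance, $B(x,R)=\{y:d(x,y)<R\}$, $S(x,R)=\{y:d(x,y)=R\}$. For $A\subset\Gamma$, $\partial A$ is the set of vertices outside $A$ adjacent to a vertex of $A$, and $T_A=\inf\{t\ge 0:X_t\in\Gamma\setminus A\}$ is the exit time. Write $T_{x,R}=T_{B(x,R)}$, $E_y(x,R)=\mathbb{E}_y(T_{B(x,R)})$,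 $E(x,R)=E_x(x,R)$, $\overline{E}(x,R)=\max_{y\in B(x,R)}E_y(x,R)$. Condition $(\overline{E})$: there is $C>0$ with $\overline{E}(x,R)\le C\,E(x,R)$ for all $x\in\Gamma$, $R>0$. Elliptic Harnack inequality $(H)$: there is $C>0$ such that for all $x\in\Gamma$, $R>0$ and every non-negative function $u$ defined on $B(x,2R)\cup\partial B(x,2R)$ and harmonic on $B(x,2R)$ (i.e. $\sum_{z}P(y,z)u(z)=u(y)$ for all $y\in B(x,2R)$), $\max_{B(x,R)}u\le C\min_{B(x,R)}u$. For a fixed constant $q$, and $x\in\Gamma$, $n\ge R>0$: $k(x,n,R)$ is the maximal integer $k$ for which $\frac{n}{k}\le q\min_{z\in B(x,R)}E(z,\frac{R}{k})$, and $k(x,n,R)=1$ by definition if there is no such integer. $\pi_{x,y}$ is the union of the vertices of the shortest paths connecting $x$ and $y$. For a fixed constant $Q$, and $x,y\in\Gamma$, $n\ge R>0$, $K>0$: $l_K(x,y,n,R)$ is the minimal integer $l$ for which $\frac{n}{l}\ge Q\max_{z\in\pi_{x,y}}E(z,\frac{KR}{l})$, and $l_K(x,y,n,R)=R$ by definition if there is no such integer. Finally $\nu(x,n,R)=\min_{y\in S(x,2R)}l_9(x,y,n,R)$.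
   Formalization: In k(x,n,R) only integers k ≤ R count, since otherwise no maximal k exists (E(z,R/k)=1 for k ≥ R). Part 2 is for n > ⌈R⌉, since for n ≤ ⌈R⌉ the probability is 0 and the bound false, and for S(x,2R) nonempty, since otherwise ν is undefined. *)

theory Defs
  imports "HOL-Probability.Probability"
begin

text \<open>
  The graph is given by its adjacency relation on the vertex type; \<open>\<mu>\<close> is only ever evaluated
  on edges.
\<close>

locale weighted_graph =
  fixes adj :: "'a \<Rightarrow> 'a \<Rightarrow> bool"
    and \<mu> :: "'a \<Rightarrow> 'a \<Rightarrow> real"
  assumes infinite_vertices: "infinite (UNIV :: 'a set)"
    and adj_sym: "adj x y \<Longrightarrow> adj y x"
    and adj_irrefl: "\<not> adj x x"
    and adj_connected: "adj\<^sup>*\<^sup>* x y"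
    and weight_sym: "adj x y \<Longrightarrow> \<mu> x y = \<mu> y x"
    and weight_pos: "adj x y \<Longrightarrow> 0 < \<mu> x y"
begin

subsection \<open>Distance, balls, geodesics\<close>

text \<open>A path of length \<open>n\<close> is a list of \<open>n + 1\<close> vertices.\<close>

definition path_between :: "'a \<Rightarrow> 'a list \<Rightarrow> 'a \<Rightarrow> bool" where
  "path_between x p y \<longleftrightarrow> p \<noteq> [] \<and> hd p = x \<and> last p = y \<and> successively adj p"

definition gdist :: "'a \<Rightarrow> 'a \<Rightarrow> nat" where
  "gdist x y = (LEAST n. \<exists>p. path_between x p y \<and> length p = Suc n)"

definition gball :: "'a \<Rightarrow> real \<Rightarrow> 'a set" where
  "gball x R = {y. real (gdist x y) < R}"

definition gsphere :: "'a \<Rightarrow> real \<Rightarrow> 'a set" where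
  "gsphere x R = {y. real (gdist x y) = R}"

definition outer_boundary :: "'a set \<Rightarrow> 'a set" where
  "outer_boundary A = {y. y \<notin> A \<and> (\<exists>x\<in>A. adj x y)}"

definition geodesic_hull :: "'a \<Rightarrow> 'a \<Rightarrow> 'a set" where
  "geodesic_hull x y = \<Union> {set p | p. path_between x p y \<and> length p = Suc (gdist x y)}"


subsection \<open>The random walk\<close>

text \<open>
  Local finiteness is not assumed. If the series defining \<open>vertex_weight x\<close> diverges, its
  value is \<open>0\<close>, and then \<open>trans_prob x\<close> vanishes and condition \<open>cond_p0\<close> fails. Under
  \<open>cond_p0\<close> all vertex degrees are bounded, so all balls are finite.
\<close>

definition vertex_weight :: "'a \<Rightarrow> real" where
  "vertex_weight x = (\<Sum>\<^sub>\<infinity>y\<in>{y. adj x y}. \<mu> x y)"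

definition trans_prob :: "'a \<Rightarrow> 'a \<Rightarrow> real" where
  "trans_prob x y = (if adj x y then \<mu> x y / vertex_weight x else 0)"

definition cond_p0 :: bool where
  "cond_p0 \<longleftrightarrow> (\<exists>p0>0. \<forall>x y. adj x y \<longrightarrow> p0 \<le> trans_prob x y)"

definition step_measure :: "'a \<Rightarrow> 'a measure" where
  "step_measure x = density (count_space UNIV) (\<lambda>y. ennreal (trans_prob x y))"

text \<open>
  \<open>walk_kernel x i \<omega>\<close> is the conditional law of \<open>X\<^sub>i\<close> given that \<open>X\<^sub>j = \<omega> j\<close> for
  all \<open>j < i\<close>, for the walk started at \<open>x\<close>. The law \<open>walk x\<close> on the trajectories
  \<open>nat \<Rightarrow> 'a\<close> is the one that the Ionescu-Tulcea extension theorem produces from these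
  kernels; \<open>X\<^sub>n\<close> is the coordinate map \<open>\<lambda>\<omega>. \<omega> n\<close>.
\<close>

definition walk_kernel :: "'a \<Rightarrow> nat \<Rightarrow> (nat \<Rightarrow> 'a) \<Rightarrow> 'a measure" where
  "walk_kernel x i \<omega> =
     (case i of 0 \<Rightarrow> return (count_space UNIV) x | Suc j \<Rightarrow> step_measure (\<omega> j))"

definition walk :: "'a \<Rightarrow> (nat \<Rightarrow> 'a) measure" where
  "walk x = projective_family.lim UNIV
     (Ionescu_Tulcea.CI (walk_kernel x) (\<lambda>_. count_space UNIV)) (\<lambda>_. count_space UNIV)"

lemma exists_adj: "\<exists>y. adj x y"
proof -
  obtain z where "z \<noteq> x" using ex_new_if_finite[OF infinite_vertices, of "{x}"] by auto
  with adj_connected[of x z] show ?thesis by (auto elim: converse_rtranclpE)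
qed

lemma finite_adj:
  assumes cond_p0 shows "finite {y. adj x y}"
proof (rule ccontr)
  assume inf: "infinite {y. adj x y}"
  from assms obtain p0 where p0: "p0 > 0" "\<And>x y. adj x y \<Longrightarrow> p0 \<le> trans_prob x y"
    by (auto simp: cond_p0_def)
  obtain y0 where y0: "adj x y0" using exists_adj by blast
  have nz: "vertex_weight x \<noteq> 0"
    using p0(2)[OF y0] p0(1) y0 by (auto simp: trans_prob_def)
  have sm: "\<mu> x summable_on {y. adj x y}"
    using nz unfolding vertex_weight_def by (metis infsum_not_exists)
  have pos: "vertex_weight x > 0"
    using nz infsum_nonneg[of "{y. adj x y}" "\<mu> x"] weight_pos[of x]
    unfolding vertex_weight_def by (fastforce simp: less_le)
  have ge: "p0 * vertex_weight x \<le> \<mu> x y" if "adj x y" for y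
    using p0(2)[OF that] that pos by (simp add: trans_prob_def field_simps)
  obtain N :: nat where N: "1 / p0 < real N" using reals_Archimedean2 by blast
  obtain F where F: "finite F" "F \<subseteq> {y. adj x y}" "card F = N"
    using infinite_arbitrarily_large[OF inf] by blast
  have "real N * (p0 * vertex_weight x) \<le> (\<Sum>y\<in>F. \<mu> x y)"
    using F sum_mono[of F "\<lambda>_. p0 * vertex_weight x" "\<mu> x"] ge by auto
  also have "\<dots> \<le> vertex_weight x"
    unfolding vertex_weight_def using F weight_pos[of x]
    by (intro finite_sum_le_infsum[OF sm]) (auto intro: less_imp_le)
  finally show False using N pos p0(1) by (simp add: field_simps)
qed

lemma trans_prob_nonneg:
  assumes cond_p0 shows "0 \<le> trans_prob x y"
  using assms by (fastforce simp: cond_p0_def trans_prob_def)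

lemma prob_space_step_measure:
  assumes cond_p0 shows "prob_space (step_measure x)"
proof
  have fin: "finite {y. adj x y}" by (rule finite_adj[OF assms])
  have vw: "vertex_weight x = (\<Sum>y\<in>{y. adj x y}. \<mu> x y)"
    using fin by (simp add: vertex_weight_def)
  have pos: "vertex_weight x > 0"
    unfolding vw using fin exists_adj[of x] weight_pos by (intro sum_pos) auto
  have "emeasure (step_measure x) (space (step_measure x))
      = (\<integral>\<^sup>+y. ennreal (trans_prob x y) \<partial>count_space UNIV)"
    by (simp add: step_measure_def emeasure_density)
  also have "\<dots> = (\<Sum>y\<in>{y. adj x y}. ennreal (trans_prob x y))"
    using fin by (intro nn_integral_count_space') (auto simp: trans_prob_def)
  also have "\<dots> = ennreal (\<Sum>y\<in>{y. adj x y}. trans_prob x y)"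
    by (intro sum_ennreal trans_prob_nonneg assms)
  also have "(\<Sum>y\<in>{y. adj x y}. trans_prob x y) = 1"
    using pos vw by (simp add: trans_prob_def sum_divide_distrib[symmetric])
  finally show "emeasure (step_measure x) (space (step_measure x)) = 1" by simp
qed

lemma Ionescu_Tulcea_walk:
  assumes cond_p0 shows "Ionescu_Tulcea (walk_kernel x) (\<lambda>_. count_space UNIV)"
proof (rule Ionescu_Tulcea.intro)
  show "walk_kernel x i \<in> measurable (PiM {0..<i} (\<lambda>_. count_space UNIV))
      (subprob_algebra (count_space UNIV))" for i
  proof (cases i)
    case 0
    have "return (count_space UNIV) x \<in> space (subprob_algebra (count_space UNIV))"
      by (simp add: space_subprob_algebra prob_space_return prob_space_imp_subprob_space)
    with 0 show ?thesis
      by (simp add: walk_kernel_def[abs_def])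
  next
    case (Suc j)
    have "step_measure \<in> measurable (count_space UNIV) (subprob_algebra (count_space UNIV))"
      using prob_space_step_measure[OF assms]
      by (auto simp: space_subprob_algebra prob_space_imp_subprob_space step_measure_def)
    then have "(\<lambda>\<omega>. step_measure (\<omega> j)) \<in> measurable (PiM {0..<i} (\<lambda>_. count_space UNIV))
      (subprob_algebra (count_space UNIV))"
      using Suc by (intro measurable_compose[OF measurable_component_singleton]) auto
    then show ?thesis using Suc by (simp add: walk_kernel_def[abs_def])
  qed
  show "prob_space (walk_kernel x i \<omega>)"
    if "\<omega> \<in> space (PiM {0..<i} (\<lambda>_. count_space UNIV))" for i \<omega>
    by (cases i) (auto simp: walk_kernel_def prob_space_return prob_space_step_measure[OF assms])
qed

lemma prob_space_walk:
  assumes cond_p0 shows "prob_space (walk x)"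
proof -
  interpret IT: Ionescu_Tulcea "walk_kernel x" "\<lambda>_. count_space UNIV"
    by (rule Ionescu_Tulcea_walk[OF assms])
  have "emeasure IT.PF.lim (IT.PF.emb UNIV {} {\<lambda>_. undefined}) = 1"
    using IT.lim[of "{}" "{\<lambda>_. undefined}"]
       prob_space.emeasure_space_1[OF IT.PF.prob_space_P[of "{}"]]
    by (simp add: IT.PF.space_P space_PiM_empty sets_PiM_empty)
  then show ?thesis unfolding walk_def
    by (intro prob_spaceI) (auto simp: prod_emb_def space_PiM restrict_def[abs_def] PiE_def extensional_def)
qed

text \<open>The finite-dimensional laws of \<open>walk x\<close>, which determine it.\<close>

lemma emeasure_walk_path:
  assumes cond_p0
  shows "emeasure (walk x) {\<omega>. \<forall>i\<le>n. \<omega> i = p i} =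
    (if p 0 = x then (\<Prod>i<n. ennreal (trans_prob (p i) (p (Suc i)))) else 0)"
proof -
  interpret IT: Ionescu_Tulcea "walk_kernel x" "\<lambda>_. count_space UNIV"
    by (rule Ionescu_Tulcea_walk[OF assms])
  let ?M = "\<lambda>_::nat. count_space (UNIV :: 'a set)"
  define A where "A n = PiE {0..<n} (\<lambda>i. {p i})" for n :: nat
  have A: "A n \<in> sets (PiM {0..<n} ?M)" for n unfolding A_def by (intro sets_PiM_I_finite) auto
  have C: "emeasure (IT.C 0 (Suc n) (\<lambda>_. undefined)) (A (Suc n)) =
      emeasure (IT.C 0 n (\<lambda>_. undefined)) (A n) * emeasure (walk_kernel x n p) {p n}" for n
  proof -
    have u: "(\<lambda>_. undefined) \<in> space (PiM {0..<0} ?M)" by (simp add: space_PiM)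
    have "emeasure (IT.C 0 (Suc n) (\<lambda>_. undefined)) (A (Suc n)) =
       (\<integral>\<^sup>+\<omega>. emeasure (IT.eP n \<omega>) (A (Suc n)) \<partial>IT.C 0 n (\<lambda>_. undefined))"
      using A[of "Suc n"] IT.measurable_eP[of n] IT.space_C[OF u, of n] IT.sets_C[OF u, of n]
      by (simp, subst emeasure_bind[where N="PiM {0..<Suc n} ?M"])
         (auto simp: space_PiM cong: measurable_cong_sets)
    also have "\<dots> = (\<integral>\<^sup>+\<omega>. emeasure (walk_kernel x n p) {p n} * indicator (A n) \<omega>
         \<partial>IT.C 0 n (\<lambda>_. undefined))"
    proof (rule nn_integral_cong)
      fix \<omega> assume "\<omega> \<in> space (IT.C 0 n (\<lambda>_. undefined))"
      then have w: "\<omega> \<in> space (PiM {0..<n} ?M)" using IT.space_C[OF u, of n] by simp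
      have e: "\<omega> i = undefined" if "\<not> i < n" for i
        using w that by (auto simp: space_PiM PiE_def extensional_def)
      have k: "walk_kernel x n \<omega> = walk_kernel x n p" if "\<omega> \<in> A n"
        using that by (cases n) (auto simp: A_def walk_kernel_def PiE_iff)
      have "fun_upd \<omega> n y \<in> A (Suc n) \<longleftrightarrow> y = p n \<and> (\<forall>i<n. \<omega> i = p i)" for y
        using e by (auto simp: A_def PiE_iff extensional_def less_Suc_eq atLeast0LessThan)
      moreover have "\<omega> \<in> A n \<longleftrightarrow> (\<forall>i<n. \<omega> i = p i)"
        using e by (auto simp: A_def PiE_iff extensional_def)
      ultimately have "fun_upd \<omega> n -` A (Suc n) = (if \<omega> \<in> A n then {p n} else {})"
        by auto
      then show "emeasure (IT.eP n \<omega>) (A (Suc n)) =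
          emeasure (walk_kernel x n p) {p n} * indicator (A n) \<omega>"
        using k by (simp add: IT.emeasure_eP[OF w A])
    qed
    also have "\<dots> = emeasure (IT.C 0 n (\<lambda>_. undefined)) (A n) * emeasure (walk_kernel x n p) {p n}"
      using A[of n] IT.sets_C[OF u, of n]
      by (subst nn_integral_cmult_indicator) (simp_all add: mult.commute)
    finally show ?thesis .
  qed
  have C0: "emeasure (IT.C 0 0 (\<lambda>_. undefined)) (A 0) = 1"
    by (simp add: A_def PiM_empty sets_PiM_empty)
  have k0: "emeasure (walk_kernel x 0 p) {p 0} = (if p 0 = x then 1 else 0)"
    by (simp add: walk_kernel_def)
  have kS: "emeasure (walk_kernel x (Suc n) p) {p (Suc n)} = ennreal (trans_prob (p n) (p (Suc n)))" for n
    by (simp add: walk_kernel_def step_measure_def emeasure_density)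
  have main: "emeasure (IT.C 0 (Suc n) (\<lambda>_. undefined)) (A (Suc n)) =
     (if p 0 = x then (\<Prod>i<n. ennreal (trans_prob (p i) (p (Suc i)))) else 0)" for n
  proof (induction n)
    case 0 show ?case using C[of 0] C0 k0 by simp
  next
    case (Suc n) show ?case unfolding C[of "Suc n"] Suc kS by simp
  qed
  have "{\<omega>. \<forall>i\<le>n. \<omega> i = p i} = IT.PF.emb UNIV {0..<Suc n} (A (Suc n))"
    by (auto simp: prod_emb_def A_def space_PiM PiE_iff less_Suc_eq_le)
  then have "emeasure (walk x) {\<omega>. \<forall>i\<le>n. \<omega> i = p i} = emeasure (IT.CI {0..<Suc n}) (A (Suc n))"
    using IT.lim[OF _ A[of "Suc n"]] by (simp add: walk_def)
  also have "\<dots> = emeasure (IT.C 0 (Suc n) (\<lambda>_. undefined)) (A (Suc n))"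
    using IT.emeasure_CI[OF order_refl A[of "Suc n"]] A[of "Suc n", THEN sets.sets_into_space]
    by (simp add: prod_emb_id space_PiM del: IT.C.simps)
  finally show ?thesis using main by simp
qed


subsection \<open>Exit times\<close>

text \<open>The exit time is \<open>\<infinity>\<close> on trajectories that never leave \<open>A\<close>.\<close>

definition exit_time :: "'a set \<Rightarrow> (nat \<Rightarrow> 'a) \<Rightarrow> enat" where
  "exit_time A \<omega> = (INF t\<in>{t. \<omega> t \<notin> A}. enat t)"

definition mean_exit_from :: "'a \<Rightarrow> 'a \<Rightarrow> real \<Rightarrow> ennreal" where
  "mean_exit_from y x R = (\<integral>\<^sup>+\<omega>. ennreal_of_enat (exit_time (gball x R) \<omega>) \<partial>walk y)"

definition mean_exit :: "'a \<Rightarrow> real \<Rightarrow> ennreal" where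
  "mean_exit x R = mean_exit_from x x R"

definition max_mean_exit :: "'a \<Rightarrow> real \<Rightarrow> ennreal" where
  "max_mean_exit x R = Max ((\<lambda>y. mean_exit_from y x R) ` gball x R)"

definition cond_Ebar :: bool where
  "cond_Ebar \<longleftrightarrow> (\<exists>C>0. \<forall>x. \<forall>R>0. max_mean_exit x R \<le> ennreal C * mean_exit x R)"


subsection \<open>Elliptic Harnack inequality\<close>

definition harmonic_on :: "('a \<Rightarrow> real) \<Rightarrow> 'a set \<Rightarrow> bool" where
  "harmonic_on u A \<longleftrightarrow> (\<forall>y\<in>A. (\<Sum>\<^sub>\<infinity>z. trans_prob y z * u z) = u y)"

text \<open>
  Functions on \<open>gball x (2 * R) \<union> outer_boundary (gball x (2 * R))\<close> are represented by total
  functions; the condition does not depend on their values elsewhere.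
\<close>

definition elliptic_harnack :: bool where
  "elliptic_harnack \<longleftrightarrow>
     (\<exists>C>0. \<forall>x. \<forall>R>0. \<forall>u.
        (\<forall>y \<in> gball x (2 * R) \<union> outer_boundary (gball x (2 * R)). 0 \<le> u y) \<longrightarrow>
        harmonic_on u (gball x (2 * R)) \<longrightarrow>
        Max (u ` gball x R) \<le> C * Min (u ` gball x R))"


subsection \<open>The exponents\<close>

text \<open>
  The maximum defining \<open>k_exponent\<close> is over the integers \<open>k\<close> for which the radius \<open>R / k\<close> is at
  least \<open>1\<close>. Smaller radii have to be excluded: for \<open>0 < R / k \<le> 1\<close> the ball of radius \<open>R / k\<close>
  about \<open>z\<close> is \<open>{z}\<close> and its mean exit time is \<open>1\<close>, so the inequality \<open>n / k \<le> q\<close> would hold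
  for all large \<open>k\<close> and there would be no maximal one.
\<close>

definition k_admissible :: "real \<Rightarrow> 'a \<Rightarrow> nat \<Rightarrow> real \<Rightarrow> nat \<Rightarrow> bool" where
  "k_admissible q x n R k \<longleftrightarrow>
     1 \<le> k \<and> 1 \<le> R / real k \<and>
     ennreal (real n / real k) \<le> ennreal q * Min ((\<lambda>z. mean_exit z (R / real k)) ` gball x R)"

definition k_exponent :: "real \<Rightarrow> 'a \<Rightarrow> nat \<Rightarrow> real \<Rightarrow> nat" where
  "k_exponent q x n R =
     (if \<exists>k. k_admissible q x n R k then Max {k. k_admissible q x n R k} else 1)"

definition l_admissible ::
  "real \<Rightarrow> real \<Rightarrow> 'a \<Rightarrow> 'a \<Rightarrow> nat \<Rightarrow> real \<Rightarrow> nat \<Rightarrow> bool" where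
  "l_admissible Q K x y n R l \<longleftrightarrow>
     1 \<le> l \<and>
     ennreal (real n / real l) \<ge>
       ennreal Q * Max ((\<lambda>z. mean_exit z (K * R / real l)) ` geodesic_hull x y)"

definition l_exponent :: "real \<Rightarrow> real \<Rightarrow> 'a \<Rightarrow> 'a \<Rightarrow> nat \<Rightarrow> real \<Rightarrow> real" where
  "l_exponent Q K x y n R =
     (if \<exists>l. l_admissible Q K x y n R l then real (LEAST l. l_admissible Q K x y n R l) else R)"

text \<open>
  The sphere of radius \<open>2 * R\<close> is empty, and the minimum unspecified, unless \<open>2 * R\<close> is an
  integer. When \<open>nu_exponent\<close> occurs in a lower bound for the probability that the exit time of
  \<open>gball x R\<close> is less than \<open>n\<close>, one needs \<open>n > \<lceil>R\<rceil>\<close>: that exit time is never less than \<open>\<lceil>R\<rceil>\<close>.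
\<close>

definition nu_exponent :: "real \<Rightarrow> 'a \<Rightarrow> nat \<Rightarrow> real \<Rightarrow> real" where
  "nu_exponent Q x n R = Min ((\<lambda>y. l_exponent Q 9 x y n R) ` gsphere x (2 * R))"

end

end

theory Submission
  imports Defs
begin

text \<open>
  Everything is reduced to the one-step averaging operator \<open>avg\<close>, so that the strong Markov
  property is replaced by comparison of sub- and supersolutions.

  Upper bound. Under \<open>cond_Ebar\<close> the mean exit time from a ball of radius \<open>R / k\<close> is at most a
  constant times its value at the centre. This makes the Laplace transform of that exit time, at
  a parameter inverse to the mean exit time, at most some \<open>\<epsilon> < 1\<close> at the centre. The walk crosses
  about \<open>k / 2\<close> such balls one after the other before it leaves \<open>gball x R\<close>.

  Lower bound. The walk is made to visit balls of radius \<open>16 * m\<close>, with \<open>m\<close> of order \<open>R / l\<close>,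
  around points at spacing \<open>80 * m\<close> on a geodesic. By the Harnack inequality and the symmetry of
  the Green function, this Green function is comparable at all points at distance \<open>16 * m\<close> from its
  pole, and further away by a Harnack chain. Hence each ball is reached from the previous one,
  before a much larger ball is left, with probability at least \<open>1 / hit_const\<close>. As mean exit times are
  controlled only from the points of the geodesic, the lower bound that is propagated from
  one ball to the previous one carries a correction proportional to the mean exit time from the
  current point.
\<close>

subsection \<open>Distance and geodesics\<close>

context weighted_graph
begin

text \<open>Vertex lists become relational powers, so that concatenating, reversing and cutting
  paths are facts about \<open>adj ^^ n\<close>.\<close>

lemma ex_path_between_iff: "(\<exists>p. path_between x p y \<and> length p = Suc n) \<longleftrightarrow> (adj ^^ n) x y"
proof
  assume "\<exists>p. path_between x p y \<and> length p = Suc n"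
  then obtain p where p: "p \<noteq> []" "hd p = x" "last p = y" "successively adj p" "length p = Suc n"
    by (auto simp: path_between_def)
  show "(adj ^^ n) x y"
    unfolding relpowp_fun_conv
    using p by (intro exI[of _ "\<lambda>i. p ! i"])
      (auto simp: hd_conv_nth last_conv_nth successively_conv_nth)
next
  assume "(adj ^^ n) x y"
  then obtain f where f: "f 0 = x" "f n = y" "\<forall>i<n. adj (f i) (f (Suc i))"
    unfolding relpowp_fun_conv by blast
  show "\<exists>p. path_between x p y \<and> length p = Suc n"
    using f by (intro exI[of _ "map f [0..<Suc n]"])
      (auto simp: path_between_def hd_map last_map successively_conv_nth simp del: upt_Suc)
qed

lemma gdist_alt: "gdist x y = (LEAST n. (adj ^^ n) x y)"
  unfolding gdist_def ex_path_between_iff ..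

lemma gdist_relpowp: "(adj ^^ gdist x y) x y"
  unfolding gdist_alt using adj_connected[of x y] rtranclp_imp_relpowp LeastI_ex by metis

lemma gdist_le: "(adj ^^ n) x y \<Longrightarrow> gdist x y \<le> n"
  unfolding gdist_alt by (rule Least_le)

lemma gdist_refl [simp]: "gdist x x = 0"
  using gdist_le[of 0 x x] by simp

lemma gdist_eq_0_iff [simp]: "gdist x y = 0 \<longleftrightarrow> x = y"
  using gdist_relpowp[of x y] by auto

lemma gdist_triangle: "gdist x z \<le> gdist x y + gdist y z"
  by (rule gdist_le) (auto simp: relpowp_add intro: gdist_relpowp)

lemma gdist_sym: "gdist x y = gdist y x"
proof -
  have "gdist b a \<le> gdist a b" for a b
  proof -
    have "(adj ^^ n) b a" if "(adj ^^ n) a b" for n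
      using that
    proof (induction n arbitrary: b)
      case (Suc n)
      then obtain c where "(adj ^^ n) a c" "adj c b" by auto
      then show ?case using Suc.IH[of c] adj_sym relpowp_Suc_I2 by metis
    qed simp
    then show ?thesis using gdist_le gdist_relpowp by blast
  qed
  then show ?thesis by (simp add: antisym)
qed

lemma gdist_adj: "adj x y \<Longrightarrow> gdist x y \<le> 1"
  using gdist_le[of 1 x y] by (simp only: relpowp_1)

lemma gdist_path:
  assumes "\<And>i. i < n \<Longrightarrow> adj (f i) (f (Suc i))" "i \<le> j" "j \<le> n"
  shows "gdist (f i) (f j) \<le> j - i"
  by (rule gdist_le, unfold relpowp_fun_conv, rule exI[of _ "\<lambda>k. f (i + k)"]) (use assms in auto)

lemma geodesic:
  obtains f where "f 0 = x" "f (gdist x y) = y"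
    "\<And>i. i < gdist x y \<Longrightarrow> adj (f i) (f (Suc i))"
    "\<And>i. i \<le> gdist x y \<Longrightarrow> gdist x (f i) = i"
    "\<And>i. i \<le> gdist x y \<Longrightarrow> gdist (f i) y = gdist x y - i"
    "\<And>i. i \<le> gdist x y \<Longrightarrow> f i \<in> geodesic_hull x y"
proof -
  obtain f where f: "f 0 = x" "f (gdist x y) = y" "\<forall>i<gdist x y. adj (f i) (f (Suc i))"
    using gdist_relpowp[of x y] unfolding relpowp_fun_conv by blast
  have d: "gdist x (f i) \<le> i" "gdist (f i) y \<le> gdist x y - i" if "i \<le> gdist x y" for i
    using gdist_path[of "gdist x y" f 0 i] gdist_path[of "gdist x y" f i "gdist x y"] f that by auto
  \<comment> \<open>The two upper bounds add up to \<open>gdist x y\<close>, so by the triangle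
    inequality both are equalities.\<close>
  have e: "gdist x (f i) = i" "gdist (f i) y = gdist x y - i" if "i \<le> gdist x y" for i
    using d[OF that] that gdist_triangle[of x y "f i"] by auto
  have "path_between x (map f [0..<Suc (gdist x y)]) y"
    using f by (auto simp: path_between_def hd_map last_map successively_conv_nth simp del: upt_Suc)
  then have "f i \<in> geodesic_hull x y" if "i \<le> gdist x y" for i
    unfolding geodesic_hull_def using that
    by (intro UnionI[of "set (map f [0..<Suc (gdist x y)])"] CollectI exI[of _ "map f [0..<Suc (gdist x y)]"])
      (auto simp del: upt_Suc)
  with f e that show ?thesis by blast
qed

lemma adj_closer:
  assumes "x \<noteq> y" shows "\<exists>z. adj x z \<and> gdist z y < gdist x y"
proof -
  obtain f where f: "f 0 = x" "\<And>i. i < gdist x y \<Longrightarrow> adj (f i) (f (Suc i))"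
    "\<And>i. i \<le> gdist x y \<Longrightarrow> gdist (f i) y = gdist x y - i"
    by (rule geodesic[of x y]) (rule that)
  have "0 < gdist x y" using assms by (cases "gdist x y") auto
  with f(1) f(2)[of 0] f(3)[of 1] show ?thesis by (intro exI[of _ "f 1"]) simp
qed

lemma cond_p0_vertex_weight_pos: "cond_p0 \<Longrightarrow> 0 < vertex_weight x"
proof -
  assume c: cond_p0
  then have "vertex_weight x = (\<Sum>y\<in>{y. adj x y}. \<mu> x y)"
    by (simp add: vertex_weight_def finite_adj)
  also have "\<dots> > 0"
    using exists_adj[of x] weight_pos by (intro sum_pos finite_adj c) auto
  finally show ?thesis .
qed

end

subsection \<open>Averaging and occupation times\<close>

locale p0_graph = weighted_graph adj \<mu> for adj :: "'a \<Rightarrow> 'a \<Rightarrow> bool" and \<mu> +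
  fixes p\<^sub>0 :: real
  assumes p0_pos: "0 < p\<^sub>0"
    and p0_le: "adj x y \<Longrightarrow> p\<^sub>0 \<le> trans_prob x y"
begin

lemma cond_p0: cond_p0
  using p0_pos p0_le by (auto simp: cond_p0_def)

lemma finite_nbrs [simp]: "finite {z. adj x z}"
  by (rule finite_adj[OF cond_p0])

lemma vertex_weight_pos: "0 < vertex_weight x"
  by (rule cond_p0_vertex_weight_pos[OF cond_p0])

lemma finite_closed_ball: "finite {y. gdist x y \<le> n}"
proof (induction n)
  case (Suc n)
  have "{y. gdist x y \<le> Suc n} \<subseteq> {y. gdist x y \<le> n} \<union> (\<Union>z\<in>{y. gdist x y \<le> n}. {y. adj z y})"
  proof
    fix y assume y: "y \<in> {y. gdist x y \<le> Suc n}"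
    show "y \<in> {y. gdist x y \<le> n} \<union> (\<Union>z\<in>{y. gdist x y \<le> n}. {y. adj z y})"
    proof (cases "x = y")
      case False
      then obtain z where "adj y z" "gdist z x < gdist y x" using adj_closer[of y x] by auto
      then have "adj z y" "gdist x z \<le> n" using y adj_sym gdist_sym[of x] by auto
      then show ?thesis by auto
    qed auto
  qed
  with Suc show ?case by (auto intro: finite_subset)
qed (auto intro: finite_subset[of _ "{x}"])

lemma finite_gball [simp]: "finite (gball x R)"
proof -
  have "gball x R \<subseteq> {y. gdist x y \<le> nat \<lceil>R\<rceil>}"
    by (auto simp: gball_def) linarith
  then show ?thesis using finite_closed_ball finite_subset by blast
qed

section \<open>The one-step averaging operator\<close>

definition avg :: "('a \<Rightarrow> real) \<Rightarrow> 'a \<Rightarrow> real" where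
  "avg u y = (\<Sum>z\<in>{z. adj y z}. trans_prob y z * u z)"

lemma trans_prob_ge_0: "0 \<le> trans_prob x y"
  by (rule trans_prob_nonneg[OF cond_p0])

lemma avg_const [simp]: "avg (\<lambda>_. c) y = c"
proof -
  have "(\<Sum>z\<in>{z. adj y z}. trans_prob y z) = 1"
    using vertex_weight_pos[of y]
    by (simp add: trans_prob_def sum_divide_distrib[symmetric] vertex_weight_def)
  then show ?thesis by (simp add: avg_def sum_distrib_right[symmetric])
qed

lemma avg_mono: "(\<And>z. adj y z \<Longrightarrow> u z \<le> v z) \<Longrightarrow> avg u y \<le> avg v y"
  unfolding avg_def by (intro sum_mono mult_left_mono) (auto simp: trans_prob_ge_0)

lemma avg_nonneg: "(\<And>z. 0 \<le> u z) \<Longrightarrow> 0 \<le> avg u y"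
  using avg_mono[of y "\<lambda>_. 0" u] by simp

lemma avg_add: "avg (\<lambda>z. u z + v z) y = avg u y + avg v y"
  by (simp add: avg_def algebra_simps sum.distrib)

lemma avg_diff: "avg (\<lambda>z. u z - v z) y = avg u y - avg v y"
  by (simp add: avg_def algebra_simps sum_subtractf)

lemma avg_cmult: "avg (\<lambda>z. c * u z) y = c * avg u y"
  by (simp add: avg_def sum_distrib_left mult.left_commute)

lemma avg_divide: "avg (\<lambda>z. u z / c) y = avg u y / c"
  by (simp add: avg_def sum_divide_distrib)

lemmas avg_linear = avg_add avg_diff avg_cmult avg_divide

lemma avg_ge_p0:
  assumes "\<And>z. 0 \<le> u z" "adj y z" shows "p\<^sub>0 * u z \<le> avg u y"
proof -
  have "p\<^sub>0 * u z \<le> trans_prob y z * u z"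
    using p0_le assms by (intro mult_right_mono) auto
  also have "\<dots> \<le> avg u y"
    unfolding avg_def using assms trans_prob_ge_0 by (intro member_le_sum) auto
  finally show ?thesis .
qed

lemma infsum_trans_prob: "(\<Sum>\<^sub>\<infinity>z. trans_prob y z * u z) = avg u y"
proof -
  have "(\<Sum>\<^sub>\<infinity>z. trans_prob y z * u z) = (\<Sum>\<^sub>\<infinity>z\<in>{z. adj y z}. trans_prob y z * u z)"
    by (rule infsum_cong_neutral) (auto simp: trans_prob_def)
  then show ?thesis by (simp add: avg_def)
qed

lemma harmonic_on_iff: "harmonic_on u A \<longleftrightarrow> (\<forall>y\<in>A. avg u y = u y)"
  by (simp add: harmonic_on_def infsum_trans_prob)

text \<open>
  \<open>stay D n v\<close> is the probability that the walk from \<open>v\<close> is in \<open>D\<close> at all times less than \<open>n\<close>, and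
  \<open>occ D f v\<close> is the mean of the sum of \<open>f\<close> along the walk from \<open>v\<close> until it leaves \<open>D\<close>.
\<close>

primrec stay :: "'a set \<Rightarrow> nat \<Rightarrow> 'a \<Rightarrow> real" where
  "stay D 0 = (\<lambda>_. 1)"
| "stay D (Suc n) = (\<lambda>v. if v \<in> D then avg (stay D n) v else 0)"

text \<open>With \<open>T\<close> the exit time from \<open>D\<close>, this is the mean of
  \<open>f (X_n)\<close> on the event \<open>n < T\<close>.\<close>

primrec killed :: "'a set \<Rightarrow> ('a \<Rightarrow> real) \<Rightarrow> nat \<Rightarrow> 'a \<Rightarrow> real" where
  "killed D f 0 = (\<lambda>v. if v \<in> D then f v else 0)"
| "killed D f (Suc n) = (\<lambda>v. if v \<in> D then avg (killed D f n) v else 0)"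

definition occ :: "'a set \<Rightarrow> ('a \<Rightarrow> real) \<Rightarrow> 'a \<Rightarrow> real" where
  "occ D f v = (\<Sum>n. killed D f n v)"

text \<open>\<open>stay D n\<close> looks at the times before \<open>n\<close>,
  \<open>killed D f n\<close> at the times up to \<open>n\<close>; hence the index shift.\<close>

lemma stay_Suc: "stay D (Suc n) = killed D (\<lambda>_. 1) n"
  by (induction n) auto

lemma stay_nonneg: "0 \<le> stay D n v"
  by (induction n arbitrary: v) (auto intro: avg_nonneg)

lemma stay_Suc_le: "stay D (Suc n) v \<le> stay D n v"
proof (induction n arbitrary: v)
  case (Suc n)
  then show ?case using avg_mono[of v "stay D (Suc n)" "stay D n"] by simp
qed simp

lemma stay_antimono: "m \<le> n \<Longrightarrow> stay D n v \<le> stay D m v"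
  using lift_Suc_antimono_le[of "\<lambda>n. stay D n v"] stay_Suc_le by blast

lemma stay_le_1: "stay D n v \<le> 1"
  using stay_antimono[of 0 n D v] by simp

lemma killed_nonneg: "(\<And>v. 0 \<le> f v) \<Longrightarrow> 0 \<le> killed D f n v"
  by (induction n arbitrary: v) (auto intro: avg_nonneg)

lemma killed_mono:
  "(\<And>v. v \<in> D \<Longrightarrow> f v \<le> g v) \<Longrightarrow> (\<And>v. 0 \<le> g v) \<Longrightarrow> D \<subseteq> D' \<Longrightarrow> killed D f n v \<le> killed D' g n v"
proof (induction n arbitrary: v)
  case (Suc n)
  then have "avg (killed D f n) v \<le> avg (killed D' g n) v" "0 \<le> avg (killed D' g n) v"
    by (auto intro!: avg_mono avg_nonneg killed_nonneg)
  then show ?case using Suc.prems(3) by auto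
qed auto

lemma killed_add: "killed D (\<lambda>v. f v + g v) n = (\<lambda>v. killed D f n v + killed D g n v)"
  by (induction n) (auto simp: avg_add)

lemma killed_cmult: "killed D (\<lambda>v. c * f v) n = (\<lambda>v. c * killed D f n v)"
  by (induction n) (auto simp: avg_cmult)

text \<open>
  With \<open>b\<close> outside \<open>D\<close> and \<open>\<gamma> \<le> p\<^sub>0 / 2\<close>, the function \<open>\<gamma> ^ gdist b v\<close> at least doubles in the mean
  at each step, so an affine function of it bounds the mean exit time.
\<close>

lemma sum_stay_bounded:
  assumes "finite D"
  obtains c where "\<And>n v. (\<Sum>i<n. stay D (Suc i) v) \<le> c"
proof -
  obtain b where b: "b \<notin> D" using ex_new_if_finite[OF infinite_vertices assms] by blast
  define \<gamma> where "\<gamma> = min (p\<^sub>0 / 2) (1 / 2)"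
  have g: "0 < \<gamma>" "\<gamma> < 1" "2 * \<gamma> \<le> p\<^sub>0" using p0_pos by (auto simp: \<gamma>_def)
  define N where "N = Max (insert 0 ((\<lambda>v. gdist v b) ` D))"
  have N: "gdist v b \<le> N" if "v \<in> D" for v
    using assms that by (auto simp: N_def)
  define w where "w v = \<gamma> ^ gdist v b" for v
  have w: "0 < w v" "w v \<le> 1" for v using g by (auto simp: w_def power_le_one)
  have wN: "\<gamma> ^ N \<le> w v" if "v \<in> D" for v
    unfolding w_def using g N[OF that] by (intro power_decreasing) auto
  have drift: "avg w v \<ge> w v + \<gamma> ^ N" if v: "v \<in> D" for v
  proof -
    \<comment> \<open>A neighbour nearer to \<open>b\<close> alone doubles the mean, since
      \<open>w z \<ge> w v / \<gamma>\<close>. Of this only the gain \<open>\<gamma> ^ N\<close>,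
      uniform on \<open>D\<close>, is kept.\<close>
    obtain z where z: "adj v z" "gdist z b < gdist v b" using adj_closer b v by metis
    have "2 * w v \<le> p\<^sub>0 * w z"
    proof -
      have "w v \<le> \<gamma> ^ Suc (gdist z b)"
        unfolding w_def using g z by (intro power_decreasing) auto
      then have "2 * w v \<le> (2 * \<gamma>) * w z" by (simp add: w_def)
      also have "\<dots> \<le> p\<^sub>0 * w z" using g w[of z] by (intro mult_right_mono) auto
      finally show ?thesis .
    qed
    also have "\<dots> \<le> avg w v" using z w by (intro avg_ge_p0) (auto intro: less_imp_le)
    finally show ?thesis using wN[OF v] by simp
  qed
  have "(\<Sum>i<n. stay D (Suc i) v) \<le> (1 - w v) / \<gamma> ^ N" for n v
  proof (induction n arbitrary: v)
    case 0 then show ?case using w g by simp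
  next
    case (Suc n)
    show ?case
    proof (cases "v \<in> D")
      case True
      have "(\<Sum>i<Suc n. stay D (Suc i) v) = 1 + (\<Sum>i<n. stay D (Suc (Suc i)) v)"
        using True by (subst sum.lessThan_Suc_shift) simp
      also have "(\<Sum>i<n. stay D (Suc (Suc i)) v) = avg (\<lambda>u. \<Sum>i<n. stay D (Suc i) u) v"
        using True unfolding stay.simps(2)[of D "Suc _"] avg_def
        by (simp add: sum_distrib_left del: stay.simps) (rule sum.swap)
      also have "\<dots> \<le> avg (\<lambda>u. (1 - w u) / \<gamma> ^ N) v" by (intro avg_mono Suc)
      also have "\<dots> = (1 - avg w v) / \<gamma> ^ N" by (simp add: avg_linear)
      also have "1 + \<dots> = (\<gamma> ^ N + 1 - avg w v) / \<gamma> ^ N"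
        using g by (simp add: field_simps)
      also have "\<dots> \<le> (1 - w v) / \<gamma> ^ N"
        using drift[OF True] g by (intro divide_right_mono) auto
      finally show ?thesis by simp
    qed (use w g in simp)
  qed
  moreover have "(1 - w v) / \<gamma> ^ N \<le> 1 / \<gamma> ^ N" for v
    using w[of v] g by (intro divide_right_mono) auto
  ultimately show ?thesis by (intro that[of "1 / \<gamma> ^ N"]) (rule order_trans)
qed

lemma summable_stay:
  assumes "finite D" shows "summable (\<lambda>n. stay D (Suc n) v)"
proof -
  obtain c where "\<And>n v. (\<Sum>i<n. stay D (Suc i) v) \<le> c" using sum_stay_bounded[OF assms] by metis
  then show ?thesis
    by (intro summableI_nonneg_bounded[of _ c]) (auto simp del: stay.simps simp: stay_nonneg)
qed

lemma stay_tendsto_0: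
  assumes "finite D" shows "(\<lambda>n. stay D n v) \<longlonglongrightarrow> 0"
  using summable_LIMSEQ_zero[OF summable_stay[OF assms, of v]] filterlim_sequentially_Suc
  by blast

lemma summable_killed:
  assumes D: "finite D" and f: "\<And>v. 0 \<le> f v"
  shows "summable (\<lambda>n. killed D f n v)"
proof -
  define c where "c = (\<Sum>v\<in>D. f v)"
  have c: "f v \<le> c" if "v \<in> D" for v
    unfolding c_def using that D f by (intro member_le_sum) auto
  have c0: "0 \<le> c" unfolding c_def by (intro sum_nonneg f)
  have "norm (killed D f n v) \<le> c * stay D (Suc n) v" for n
    using killed_mono[of D f "\<lambda>_. c * 1" D n v] c c0 killed_nonneg[of f D n v] f
    unfolding stay_Suc killed_cmult by simp
  then show ?thesis
    by (rule summable_comparison_test'[OF summable_mult[OF summable_stay[OF D]], of 0])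
qed

lemma occ_outside: "v \<notin> D \<Longrightarrow> occ D f v = 0"
proof -
  assume "v \<notin> D"
  then have "killed D f n v = 0" for n by (cases n) auto
  then show ?thesis by (simp add: occ_def)
qed

lemma occ_nonneg:
  assumes "finite D" "\<And>v. 0 \<le> f v" shows "0 \<le> occ D f v"
  unfolding occ_def using assms by (intro suminf_nonneg summable_killed killed_nonneg)

text \<open>First-step analysis. Together with \<open>occ_outside\<close> this is the Poisson
  equation on \<open>D\<close> with zero boundary values.\<close>

lemma occ_eq:
  assumes D: "finite D" and f: "\<And>v. 0 \<le> f v" and v: "v \<in> D"
  shows "occ D f v = f v + avg (occ D f) v"
proof -
  have s: "summable (\<lambda>n. killed D f n v)" for v using D f by (rule summable_killed)
  have "occ D f v = f v + (\<Sum>n. killed D f (Suc n) v)"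
    unfolding occ_def using suminf_split_head[OF s[of v]] v by simp
  also have "(\<Sum>n. killed D f (Suc n) v) = avg (occ D f) v"
    using v unfolding avg_def occ_def killed.simps(2)
    by (simp add: suminf_sum summable_mult s suminf_mult)
  finally show ?thesis .
qed

lemma occ_mono:
  assumes "finite D'" "D \<subseteq> D'" "\<And>v. 0 \<le> f v" "\<And>v. f v \<le> g v"
  shows "occ D f v \<le> occ D' g v"
proof -
  have "0 \<le> g v" for v using assms(3,4) order_trans by blast
  then show ?thesis
    unfolding occ_def using assms
    by (intro suminf_le killed_mono summable_killed) (auto intro: finite_subset)
qed

lemma occ_add:
  assumes "finite D" "\<And>v. 0 \<le> f v" "\<And>v. 0 \<le> g v"
  shows "occ D (\<lambda>v. f v + g v) v = occ D f v + occ D g v"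
  unfolding occ_def killed_add using assms by (intro suminf_add[symmetric] summable_killed) auto

lemma occ_superharmonic:
  assumes D: "finite D" and f: "\<And>v. 0 \<le> f v"
  shows "v \<in> D \<Longrightarrow> avg (occ D f) v \<le> occ D f v"
  using occ_eq[of D f v] assms by simp

text \<open>Markov's inequality for the exit time: \<open>stay\<close> decreases in time, so each of
  the first \<open>n\<close> terms of the series is at least \<open>stay D n v\<close>.\<close>

lemma stay_le_occ:
  assumes "finite D" shows "real n * stay D n v \<le> occ D (\<lambda>_. 1) v"
proof -
  have "real n * stay D n v = (\<Sum>i<n. stay D n v)" by simp
  also have "\<dots> \<le> (\<Sum>i<n. stay D (Suc i) v)" by (intro sum_mono stay_antimono) auto
  also have "\<dots> \<le> occ D (\<lambda>_. 1) v"
    unfolding occ_def stay_Suc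
    using summable_killed[OF assms, of "\<lambda>_. 1"] by (intro sum_le_suminf) (auto intro: killed_nonneg)
  finally show ?thesis .
qed

lemma occ_ge_1:
  assumes "finite D" "v \<in> D" shows "1 \<le> occ D (\<lambda>_. 1) v"
  using occ_eq[OF assms(1) _ assms(2), of "\<lambda>_. 1"] avg_nonneg[of "occ D (\<lambda>_. 1)"]
    occ_nonneg[OF assms(1), of "\<lambda>_. 1"] by simp

text \<open>Iterating subharmonicity \<open>n\<close> times bounds the excess over \<open>c\<close>
  by a crude bound \<open>M\<close> times the probability of being still in \<open>D\<close>, which
  tends to \<open>0\<close>.\<close>

lemma maximum_principle:
  assumes D: "finite D" and sub: "\<And>v. v \<in> D \<Longrightarrow> u v \<le> avg u v" and out: "\<And>v. v \<notin> D \<Longrightarrow> u v \<le> c"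
  shows "u v \<le> c"
proof -
  define M where "M = (\<Sum>v\<in>D. \<bar>u v - c\<bar>)"
  have M0: "0 \<le> M" unfolding M_def by (intro sum_nonneg) auto
  have M: "u v - c \<le> M" for v
  proof (cases "v \<in> D")
    case True
    have "u v - c \<le> \<bar>u v - c\<bar>" by simp
    also have "\<dots> \<le> M" unfolding M_def using True D by (intro member_le_sum) auto
    finally show ?thesis .
  qed (use out[of v] M0 in simp)
  have *: "u v \<le> c + M * stay D n v" for n v
  proof (induction n arbitrary: v)
    case 0 then show ?case using M[of v] by simp
  next
    case (Suc n)
    show ?case
    proof (cases "v \<in> D")
      case True
      have "u v \<le> avg u v" using sub True by simp
      also have "\<dots> \<le> avg (\<lambda>z. c + M * stay D n z) v" by (intro avg_mono Suc)
      also have "\<dots> = c + M * stay D (Suc n) v" using True by (simp add: avg_linear)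
      finally show ?thesis .
    qed (use out in simp)
  qed
  have "(\<lambda>n. c + M * stay D n v) \<longlonglongrightarrow> c + M * 0"
    by (intro tendsto_intros stay_tendsto_0 D)
  then show ?thesis using * by (intro LIMSEQ_le_const[of "\<lambda>n. c + M * stay D n v"]) auto
qed

subsection \<open>Exit probabilities and mean exit times of the walk\<close>

lemma sets_walk: "sets (walk x) = sets (PiM UNIV (\<lambda>_. count_space UNIV))"
proof -
  interpret IT: Ionescu_Tulcea "walk_kernel x" "\<lambda>_. count_space UNIV"
    by (rule Ionescu_Tulcea_walk[OF cond_p0])
  show ?thesis unfolding walk_def by (rule IT.PF.sets_lim)
qed

lemma space_walk [simp]: "space (walk x) = UNIV"
  using sets_eq_imp_space_eq[OF sets_walk, of x] by (simp add: space_PiM)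

lemma measurable_coordinate [measurable]: "(\<lambda>\<omega>. \<omega> i) \<in> measurable (walk x) (count_space UNIV)"
  unfolding measurable_cong_sets[OF sets_walk refl] by measurable

lemma sets_walk_coordinate [measurable]: "{\<omega>. \<omega> i \<in> D} \<in> sets (walk x)"
  using measurable_sets[OF measurable_coordinate, of D i x] by (simp add: vimage_def)

lemma sets_walk_stay: "{\<omega>. \<forall>i<k. \<omega> (j + i) \<in> D} \<in> sets (walk x)"
proof -
  have "{\<omega>. \<forall>i<k. \<omega> (j + i) \<in> D} = UNIV - (\<Union>i\<in>{..<k}. {\<omega>. \<omega> (j + i) \<in> - D})" by auto
  also have "\<dots> \<in> sets (walk x)"
  proof -
    have "(\<Union>i\<in>{..<k}. {\<omega>. \<omega> (j + i) \<in> - D}) \<in> sets (walk x)"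
      by (intro sets.finite_UN sets_walk_coordinate) auto
    then show ?thesis using sets.compl_sets space_walk by metis
  qed
  finally show ?thesis .
qed

text \<open>The Markov property for cylinder events. The fixed prefix \<open>p\<close> makes the
  induction work: one more step of staying is traded for a prefix longer by one, and the base case
  is the path law.\<close>

lemma emeasure_walk_prefix_stay:
  assumes "finite D"
  shows "emeasure (walk x) {\<omega>. (\<forall>i\<le>j. \<omega> i = p i) \<and> (\<forall>i<k. \<omega> (j + i) \<in> D)} =
    (if p 0 = x then (\<Prod>i<j. ennreal (trans_prob (p i) (p (Suc i)))) else 0) * ennreal (stay D k (p j))"
proof (induction k arbitrary: j p)
  case 0
  then show ?case using emeasure_walk_path[OF cond_p0, of x j p] by simp
next
  case (Suc k)
  let ?w = "\<lambda>j p. if p 0 = x then (\<Prod>i<j. ennreal (trans_prob (p i) (p (Suc i)))) else 0"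
  let ?S = "\<lambda>j p k. {\<omega>. (\<forall>i\<le>j. \<omega> i = p i) \<and> (\<forall>i<k. \<omega> (j + i) \<in> D)}"
  show ?case
  proof (cases "p j \<in> D")
    case False
    have "\<omega> \<notin> ?S j p (Suc k)" for \<omega>
    proof
      assume "\<omega> \<in> ?S j p (Suc k)"
      then have "\<omega> j = p j" "\<omega> (j + 0) \<in> D" by blast+
      then show "False" using False by simp
    qed
    then have "?S j p (Suc k) = {}" by blast
    then show ?thesis using False by (simp only: emeasure_empty stay.simps if_False ennreal_0 mult_zero_right)
  next
    case True
    \<comment> \<open>For \<open>k = 0\<close> the position at time \<open>Suc j\<close> is
      unrestricted; for \<open>k > 0\<close> it lies in \<open>D\<close>, and the event is a finite
      disjoint union over it.\<close>
    show ?thesis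
    proof (cases k)
      case 0
      have "?S j p (Suc 0) = {\<omega>. \<forall>i\<le>j. \<omega> i = p i}" using True by auto
      then show ?thesis using emeasure_walk_path[OF cond_p0, of x j p] 0 True by simp
    next
      case (Suc k')
      let ?p = "\<lambda>z. p(Suc j := z)"
      have S: "?S j p (Suc k) = (\<Union>z\<in>D. ?S (Suc j) (?p z) k)"
      proof (intro equalityI subsetI)
        fix \<omega> assume w: "\<omega> \<in> ?S j p (Suc k)"
        then have D: "\<omega> (j + i) \<in> D" if "i < Suc k" for i using that by auto
        have "\<omega> (Suc j) \<in> D" using D[of 1] Suc by simp
        moreover have "\<omega> (Suc j + i) \<in> D" if "i < k" for i using D[of "Suc i"] that by simp
        ultimately show "\<omega> \<in> (\<Union>z\<in>D. ?S (Suc j) (?p z) k)"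
          using w by (auto simp: le_Suc_eq)
      next
        fix \<omega> assume "\<omega> \<in> (\<Union>z\<in>D. ?S (Suc j) (?p z) k)"
        then obtain z where w: "\<omega> \<in> ?S (Suc j) (?p z) k" by blast
        then have p: "\<omega> i = p i" if "i \<le> j" for i using that by (auto split: if_splits)
        have "\<omega> (j + i) \<in> D" if "i < Suc k" for i
        proof (cases i)
          case 0 then show ?thesis using p[of j] True by simp
        next
          case (Suc i') then show ?thesis using w that by auto
        qed
        then show "\<omega> \<in> ?S j p (Suc k)" using p by blast
      qed
      have meas: "?S j p k \<in> sets (walk x)" for j p k
      proof -
        have "?S j p k = (\<Inter>i\<in>{..j}. {\<omega>. \<omega> i \<in> {p i}}) \<inter> {\<omega>. \<forall>i<k. \<omega> (j + i) \<in> D}"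
          by auto
        also have "\<dots> \<in> sets (walk x)"
          by (intro sets.Int sets.finite_INT sets_walk_coordinate sets_walk_stay) auto
        finally show ?thesis .
      qed
      have "emeasure (walk x) (?S j p (Suc k)) = (\<Sum>z\<in>D. emeasure (walk x) (?S (Suc j) (?p z) k))"
        unfolding S
        by (intro sum_emeasure[symmetric] image_subsetI meas assms) (auto simp: disjoint_family_on_def)
      also have "\<dots> = (\<Sum>z\<in>D. ?w j p * ennreal (trans_prob (p j) z * stay D k z))"
        unfolding Suc.IH by (intro sum.cong) (auto simp: ennreal_mult trans_prob_ge_0 stay_nonneg mult.assoc)
      also have "\<dots> = ?w j p * ennreal (\<Sum>z\<in>D. trans_prob (p j) z * stay D k z)"
        by (simp add: sum_distrib_left[symmetric] sum_ennreal trans_prob_ge_0 stay_nonneg)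
      \<comment> \<open>\<open>stay D k\<close> vanishes off \<open>D\<close>, as
        \<open>k > 0\<close>, and \<open>trans_prob\<close> off the neighbours, so the two index
        sets may be exchanged.\<close>
      also have "(\<Sum>z\<in>D. trans_prob (p j) z * stay D k z) = (\<Sum>z\<in>{z. adj (p j) z}. trans_prob (p j) z * stay D k z)"
      proof -
        have "stay D k z = 0" if "z \<notin> D" for z using that Suc by simp
        then show ?thesis
          using assms by (intro sum.mono_neutral_cong) (auto simp: trans_prob_def)
      qed
      also have "\<dots> = stay D (Suc k) (p j)" using True by (simp add: avg_def)
      finally show ?thesis .
    qed
  qed
qed

lemma emeasure_walk_stay:
  assumes "finite D"
  shows "emeasure (walk x) {\<omega>. \<forall>i<k. \<omega> i \<in> D} = ennreal (stay D k x)"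
proof -
  interpret prob_space "walk x" by (rule prob_space_walk[OF cond_p0])
  have start: "AE \<omega> in walk x. \<omega> 0 = x"
    using emeasure_walk_path[OF cond_p0, of x 0 "\<lambda>_. x"] sets_walk_coordinate[of 0 "{x}" x]
    by (intro AE_I_eq_1) (auto simp: emeasure_eq_measure)
  have k: "{\<omega>. \<forall>i<k. \<omega> i \<in> D} \<in> sets (walk x)" using sets_walk_stay[of k 0 D x] by simp
  have 0: "{\<omega>. \<omega> 0 = x \<and> (\<forall>i<k. \<omega> i \<in> D)} = {\<omega>. \<omega> 0 \<in> {x}} \<inter> {\<omega>. \<forall>i<k. \<omega> i \<in> D}" by auto
  have "emeasure (walk x) {\<omega>. \<forall>i<k. \<omega> i \<in> D} = emeasure (walk x) {\<omega>. \<omega> 0 = x \<and> (\<forall>i<k. \<omega> i \<in> D)}"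
    using start k unfolding 0 by (intro emeasure_eq_AE) auto
  then show ?thesis
    using emeasure_walk_prefix_stay[OF assms, of x 0 "\<lambda>_. x" k] by simp
qed

lemma enat_le_exit_time_iff: "enat n \<le> exit_time D \<omega> \<longleftrightarrow> (\<forall>i<n. \<omega> i \<in> D)"
  unfolding exit_time_def le_INF_iff by (auto simp: not_le) (meson not_le)

lemma exit_time_less_enat_iff: "exit_time D \<omega> < enat n \<longleftrightarrow> \<not> (\<forall>i<n. \<omega> i \<in> D)"
  using enat_le_exit_time_iff[of n D \<omega>] by auto

lemma prob_exit_time_less:
  assumes "finite D"
  shows "\<P>(\<omega> in walk x. exit_time D \<omega> < enat n) = 1 - stay D n x"
proof -
  interpret prob_space "walk x" by (rule prob_space_walk[OF cond_p0])
  have m: "measure (walk x) {\<omega>. \<forall>i<n. \<omega> i \<in> D} = stay D n x"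
    using emeasure_walk_stay[OF assms] stay_nonneg by (intro measure_eq_emeasure_eq_ennreal)
  have "{\<omega>. \<forall>i<n. \<omega> i \<in> D} \<in> events"
    using sets_walk_stay[of n 0 D x] by simp
  then have "prob (space (walk x) - {\<omega>. \<forall>i<n. \<omega> i \<in> D}) = 1 - stay D n x"
    using prob_compl m by simp
  moreover have "space (walk x) - {\<omega>. \<forall>i<n. \<omega> i \<in> D} = {\<omega>\<in>space (walk x). exit_time D \<omega> < enat n}"
    unfolding exit_time_less_enat_iff by auto
  ultimately show ?thesis by simp
qed

lemma measurable_exit_time: "exit_time D \<in> measurable (walk x) (count_space UNIV)"
proof -
  have s: "{\<omega>. enat n \<le> exit_time D \<omega>} \<in> sets (walk x)" for n
    using sets_walk_stay[of n 0 D x] by (simp add: enat_le_exit_time_iff)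
  have "exit_time D -` {a} \<inter> space (walk x) \<in> sets (walk x)" for a
  proof (cases a)
    case (enat n)
    then have "exit_time D -` {a} \<inter> space (walk x) =
        {\<omega>. enat n \<le> exit_time D \<omega>} - {\<omega>. enat (Suc n) \<le> exit_time D \<omega>}"
      by (auto simp: Suc_ile_eq)
    then show ?thesis using s by (simp only: sets.Diff)
  next
    case infinity
    then have "exit_time D -` {a} \<inter> space (walk x) = (\<Inter>n. {\<omega>. enat n \<le> exit_time D \<omega>})"
    proof -
      have "exit_time D \<omega> = \<infinity> \<longleftrightarrow> (\<forall>n. enat n \<le> exit_time D \<omega>)" for \<omega>
      proof (cases "exit_time D \<omega>")
        case (enat m)
        then have "\<not> enat (Suc m) \<le> exit_time D \<omega>" by simp
        with enat show ?thesis by fastforce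
      qed simp
      then show ?thesis by (simp add: infinity set_eq_iff)
    qed
    then show ?thesis using s by (auto intro!: sets.countable_INT)
  qed
  then show ?thesis by (simp add: measurable_count_space_eq2_countable)
qed

text \<open>Tail-sum formula: the mean of an \<open>enat\<close>-valued time is the sum over
  \<open>t\<close> of the probabilities that it exceeds \<open>t\<close>.\<close>

lemma mean_exit_from_eq: "mean_exit_from y x R = ennreal (occ (gball x R) (\<lambda>_. 1) y)"
proof -
  have "mean_exit_from y x R =
      (\<Sum>t. emeasure (walk y) {\<omega>\<in>space (walk y). enat t < exit_time (gball x R) \<omega>})"
    unfolding mean_exit_from_def by (rule nn_integral_enat_function[OF measurable_exit_time])
  also have "\<dots> = (\<Sum>t. ennreal (stay (gball x R) (Suc t) y))"
  proof -
    have "{\<omega>\<in>space (walk y). enat t < exit_time (gball x R) \<omega>} = {\<omega>. \<forall>i<Suc t. \<omega> i \<in> gball x R}" for t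
      using enat_le_exit_time_iff[of "Suc t" "gball x R"] by (auto simp: Suc_ile_eq)
    then show ?thesis by (simp only: emeasure_walk_stay[OF finite_gball])
  qed
  also have "\<dots> = ennreal (occ (gball x R) (\<lambda>_. 1) y)"
    unfolding occ_def stay_Suc[symmetric]
    using summable_stay[OF finite_gball, of x R y]
    by (intro suminf_ennreal2) (auto simp del: stay.simps simp: stay_nonneg)
  finally show ?thesis .
qed

lemma mean_exit_eq: "mean_exit x R = ennreal (occ (gball x R) (\<lambda>_. 1) x)"
  by (simp add: mean_exit_def mean_exit_from_eq)

subsection \<open>Upper bound\<close>

lemma stay_outside: "v \<notin> D \<Longrightarrow> 0 < n \<Longrightarrow> stay D n v = 0"
  by (cases n) auto

text \<open>
  With \<open>e\<close> the mean exit time of \<open>gball z r\<close>, the function \<open>1 - e / (2 * H)\<close> equals \<open>1\<close> off that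
  ball and is multiplied by at most \<open>exp \<theta>\<close> under \<open>avg\<close>. This gives the factor \<open>\<epsilon>\<close> per ball.
\<close>

lemma exit_prob_le_exp_power:
  assumes C: "1 \<le> C" and r: "0 < r" and \<rho>: "r \<le> real \<rho>" "\<And>d::nat. real d < r \<Longrightarrow> d < \<rho>"
    and Ebar: "\<And>z v. v \<in> gball z r \<Longrightarrow> occ (gball z r) (\<lambda>_. 1) v \<le> C * occ (gball z r) (\<lambda>_. 1) z"
    and E: "0 < E" "\<And>z. z \<in> gball x R \<Longrightarrow> E \<le> occ (gball z r) (\<lambda>_. 1) z"
    and z: "real (gdist x z + i * \<rho>) \<le> R"
  shows "1 - stay (gball x R) n z \<le> exp (real n / (C * E)) * (1 - 1 / (2 * C)) ^ i"
  using z
proof (induction i arbitrary: z n)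
  case 0
  have "1 - stay (gball x R) n z \<le> 1" using stay_nonneg[of "gball x R" n z] by simp
  also have "1 \<le> exp (real n / (C * E))" using C E by simp
  finally show ?case by simp
next
  case (Suc i)
  note IH = Suc.IH
  \<comment> \<open>\<open>H\<close> bounds \<open>e\<close> on the whole ball, and
    \<open>w z = \<epsilon>\<close> because \<open>e z = H / C\<close>. The rate
    \<open>\<theta>\<close> does not depend on \<open>z\<close>, and
    \<open>1 / H \<le> \<theta>\<close> as \<open>C * E \<le> H\<close>.\<close>
  define \<theta> where "\<theta> = 1 / (C * E)"
  define \<epsilon> where "\<epsilon> = 1 - 1 / (2 * C)"
  define e where "e = occ (gball z r) (\<lambda>_. 1)"
  define H where "H = C * e z"
  define w where "w v = 1 - e v / (2 * H)" for v
  have \<rho>0: "0 < \<rho>" using \<rho>(1) r by (cases \<rho>) auto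
  have "real (gdist x z) + real \<rho> \<le> real (gdist x z + Suc i * \<rho>)"
    by (subst of_nat_add[symmetric], subst of_nat_le_iff) simp
  also have "\<dots> \<le> R" by (rule Suc.prems)
  finally have zR: "real (gdist x z) + r \<le> R" using \<rho>(1) by simp
  then have "real (gdist x z) < R" using r by linarith
  then have z: "z \<in> gball z r" "z \<in> gball x R" using r by (auto simp: gball_def)
  have ez: "1 \<le> e z" unfolding e_def using occ_ge_1 z by simp
  have H: "1 \<le> H" unfolding H_def using ez C mult_mono[of 1 C 1 "e z"] by simp
  have eps: "0 \<le> \<epsilon>" using C by (simp add: \<epsilon>_def field_simps)
  have "C * E \<le> H" unfolding H_def e_def using E z C by (intro mult_left_mono) auto
  then have lam: "1 / H \<le> \<theta>" "0 < \<theta>" unfolding \<theta>_def using C E H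
    by (auto intro!: divide_left_mono mult_pos_pos)
  have eH: "e v \<le> H" "0 \<le> e v" for v
    using Ebar[of v z] H occ_outside[of v "gball z r"] occ_nonneg[of "gball z r" "\<lambda>_. 1" v]
    by (cases "v \<in> gball z r"; auto simp: e_def H_def)+
  have w: "1 / 2 \<le> w v" for v using eH[of v] H by (simp add: w_def field_simps)
  have w_out: "w v = 1" if "v \<notin> gball z r" for v
    using that by (simp add: w_def e_def occ_outside)
  have w_step: "avg w v \<le> exp \<theta> * w v" if "v \<in> gball z r" for v
  proof -
    \<comment> \<open>By the Poisson equation for \<open>e\<close>, averaging raises
      \<open>w\<close> by exactly \<open>1 / (2 * H)\<close>, which is at most
      \<open>\<theta> * w v\<close> since \<open>w \<ge> 1 / 2\<close>.\<close>
    have "avg w v = w v + 1 / (2 * H)"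
      using occ_eq[of "gball z r" "\<lambda>_. 1" v] that
      by (simp add: w_def[abs_def] avg_linear e_def add_divide_distrib)
    also have "1 / (2 * H) = 1 / H * (1 / 2)" by simp
    also have "\<dots> \<le> \<theta> * w v" using lam w[of v] H by (intro mult_mono) auto
    also have "w v + \<theta> * w v \<le> exp \<theta> * w v"
      using exp_ge_add_one_self[of \<theta>] w[of v] mult_right_mono[of "1 + \<theta>" "exp \<theta>" "w v"]
      by (simp add: algebra_simps)
    finally show ?thesis by simp
  qed
  \<comment> \<open>Inner induction on time; the outer one is on the number of balls. Once the walk
    is off \<open>gball z r\<close>, it is within \<open>\<rho>\<close> of \<open>z\<close>, and the
    outer hypothesis applies with \<open>i\<close> balls left.\<close>
  have "1 - stay (gball x R) n v \<le> exp (real n * \<theta>) * \<epsilon> ^ i * w v" if "gdist z v \<le> \<rho>" for n v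
    using that
  proof (induction n arbitrary: v)
    case 0
    then show ?case using w[of v] eps by simp
  next
    case (Suc n v)
    show ?case
    proof (cases "v \<in> gball z r")
      case False
      have "gdist x v + i * \<rho> \<le> gdist x z + Suc i * \<rho>"
        using gdist_triangle[of x v z] Suc.prems by simp
      then have "real (gdist x v + i * \<rho>) \<le> R"
        using Suc.prems \<open>real (gdist x z + Suc i * \<rho>) \<le> R\<close> by linarith
      from IH[OF this, of "Suc n"] show ?thesis
        using w_out[OF False] by (simp add: \<theta>_def \<epsilon>_def)
    next
      case True
      \<comment> \<open>\<open>\<rho>\<close> is an integer with \<open>gdist z v < \<rho>\<close>,
        so one more step does not pass \<open>\<rho>\<close>.\<close>
      have nb: "gdist z u \<le> \<rho>" if "adj v u" for u
        using \<rho>(2)[of "gdist z v"] True gdist_triangle[of z u v] gdist_adj[OF that]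
        by (simp add: gball_def)
      have "real (gdist x v) < R"
        using True gdist_triangle[of x v z] zR
        by (simp add: gball_def)
      then have "1 - stay (gball x R) (Suc n) v = avg (\<lambda>u. 1 - stay (gball x R) n u) v"
        by (simp add: gball_def avg_linear)
      also have "\<dots> \<le> avg (\<lambda>u. exp (real n * \<theta>) * \<epsilon> ^ i * w u) v"
        by (intro avg_mono Suc.IH nb)
      also have "\<dots> = exp (real n * \<theta>) * \<epsilon> ^ i * avg w v" by (rule avg_cmult)
      also have "\<dots> \<le> exp (real n * \<theta>) * \<epsilon> ^ i * (exp \<theta> * w v)"
        using eps by (intro mult_left_mono w_step True) auto
      also have "\<dots> = exp (real (Suc n) * \<theta>) * \<epsilon> ^ i * w v"
        by (simp add: exp_add algebra_simps)
      finally show ?thesis .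
    qed
  qed
  from this[of z n] have "1 - stay (gball x R) n z \<le> exp (real n * \<theta>) * \<epsilon> ^ i * w z" by simp
  also have "w z = \<epsilon>" using ez by (simp add: w_def \<epsilon>_def H_def)
  finally show ?case by (simp add: \<theta>_def \<epsilon>_def mult_ac)
qed

text \<open>Balance of exponents: with \<open>q = 1 / 8\<close> the time factor costs at most
  \<open>k / (8 * C)\<close>, while at least \<open>k / 2 - 1\<close> crossings gain
  \<open>1 / (2 * C)\<close> each, about \<open>k / (4 * C)\<close> in all.\<close>

lemma exit_prob_upper:
  assumes C: "1 \<le> C"
    and Ebar: "\<And>x R v. 0 < R \<Longrightarrow> v \<in> gball x R \<Longrightarrow>
      occ (gball x R) (\<lambda>_. 1) v \<le> C * occ (gball x R) (\<lambda>_. 1) x"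
    and R: "0 < R"
  shows "1 - stay (gball x R) n x \<le> exp (1 / (2 * C)) * exp (- (1 / (8 * C)) * real (k_exponent (1 / 8) x n R))"
proof (cases "\<exists>k. k_admissible (1 / 8) x n R k")
  case False
  \<comment> \<open>Here \<open>k_exponent\<close> has its default value \<open>1\<close>, and the
    claimed bound is at least \<open>1\<close>.\<close>
  have "1 \<le> exp (1 / (2 * C) - 1 / (8 * C))" using C by (simp add: field_simps)
  also have "\<dots> = exp (1 / (2 * C)) * exp (- (1 / (8 * C)))" by (simp only: exp_add[symmetric] diff_conv_add_uminus)
  finally show ?thesis using stay_nonneg[of "gball x R" n x] False by (simp add: k_exponent_def)
next
  case True
  let ?K = "{k. k_admissible (1 / 8) x n R k}"
  define k where "k = k_exponent (1 / 8) x n R"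
  \<comment> \<open>Admissible \<open>k\<close> satisfy \<open>k \<le> R\<close>, so the maximum in
    \<open>k_exponent\<close> is attained.\<close>
  have "?K \<subseteq> {..nat \<lfloor>R\<rfloor>}"
  proof
    fix k assume "k \<in> ?K"
    then have "1 \<le> k" "1 \<le> R / real k" by (auto simp: k_admissible_def)
    then have "real k \<le> R" by (simp add: field_simps)
    then show "k \<in> {..nat \<lfloor>R\<rfloor>}" using le_nat_floor by simp
  qed
  then have fin: "finite ?K" using finite_subset by blast
  have "k \<in> ?K" unfolding k_def k_exponent_def using Max_in[OF fin] True by auto
  then have k: "1 \<le> k" "1 \<le> R / real k"
    "ennreal (real n / real k) \<le> ennreal (1 / 8) * Min ((\<lambda>z. mean_exit z (R / real k)) ` gball x R)"
    by (auto simp: k_admissible_def)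
  define r where "r = R / real k"
  define \<rho> where "\<rho> = nat \<lceil>r\<rceil>"
  define F where "F z = occ (gball z r) (\<lambda>_. 1) z" for z
  define E where "E = Min (F ` gball x R)"
  have x: "x \<in> gball x R" using R by (simp add: gball_def)
  have r: "1 \<le> r" using k by (simp add: r_def)
  have F1: "1 \<le> F z" for z unfolding F_def using r by (intro occ_ge_1 finite_gball) (simp add: gball_def)
  have E: "E \<in> F ` gball x R" "\<And>z. z \<in> gball x R \<Longrightarrow> E \<le> F z"
    unfolding E_def using x by (auto intro!: Min_in)
  then have E1: "1 \<le> E" using F1 by auto
  obtain z where z: "z \<in> gball x R" "E = F z" using E(1) by blast
  note k(3)
  also have "Min ((\<lambda>z. mean_exit z (R / real k)) ` gball x R) \<le> mean_exit z r"
    unfolding r_def using z(1) by (intro Min_le) auto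
  finally have "ennreal (real n / real k) \<le> ennreal (1 / 8) * mean_exit z r"
    by (simp add: mult_left_mono)
  then have "real n / real k \<le> 1 / 8 * E"
    using E1 by (simp add: mean_exit_eq z(2) F_def ennreal_mult'[symmetric])
  then have nE: "real n \<le> real k * E / 8" using k(1) by (simp add: field_simps)
  \<comment> \<open>Rounding up at most doubles \<open>r\<close>, because
    \<open>r \<ge> 1\<close>.\<close>
  have \<rho>: "r \<le> real \<rho>" "real \<rho> \<le> 2 * r" and \<rho>_less: "\<And>d::nat. real d < r \<Longrightarrow> d < \<rho>"
    unfolding \<rho>_def using r by linarith+
  define i where "i = nat \<lfloor>R / real \<rho>\<rfloor>"
  have "real i \<le> R / real \<rho>" using R by (simp add: i_def)
  then have i: "real (i * \<rho>) \<le> R" using \<rho> r by (simp add: field_simps)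
  have "real k / 2 = R / (2 * r)" using k R by (simp add: r_def)
  also have "\<dots> \<le> R / real \<rho>" using \<rho> r R by (intro divide_left_mono) auto
  also have "\<dots> \<le> real i + 1" unfolding i_def by linarith
  finally have ik: "real k / 2 - 1 \<le> real i" by simp
  have "1 - stay (gball x R) n x \<le> exp (real n / (C * E)) * (1 - 1 / (2 * C)) ^ i"
    using r E1 E(2) i C Ebar \<rho> \<rho>_less by (intro exit_prob_le_exp_power) (auto simp: F_def)
  also have "\<dots> \<le> exp (real k / (8 * C)) * exp (- (1 / (2 * C))) ^ i"
  proof (intro mult_mono power_mono)
    have "real n / (C * E) \<le> (real k * E / 8) / (C * E)"
      using nE C E1 by (intro divide_right_mono) auto
    then show "exp (real n / (C * E)) \<le> exp (real k / (8 * C))" using E1 by (simp add: field_simps)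
    show "1 - 1 / (2 * C) \<le> exp (- (1 / (2 * C)))"
      using exp_ge_add_one_self[of "- (1 / (2 * C))"] by simp
  qed (use C in \<open>auto simp: field_simps\<close>)
  also have "\<dots> = exp (real k / (8 * C) - real i / (2 * C))"
    by (simp add: exp_of_nat_mult[symmetric] exp_add[symmetric])
  also have "\<dots> \<le> exp (real k / (8 * C) - (real k / 2 - 1) / (2 * C))"
    using divide_right_mono[OF ik, of "2 * C"] C by simp
  also have "real k / (8 * C) - (real k / 2 - 1) / (2 * C) = 1 / (2 * C) + - (1 / (8 * C)) * real k"
    using C by (simp add: field_simps)
  finally show ?thesis by (simp only: exp_add k_def)
qed

lemma cond_Ebar_occ:
  assumes cond_Ebar
  obtains C where "1 \<le> C"
    "\<And>x R v. 0 < R \<Longrightarrow> v \<in> gball x R \<Longrightarrow>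
      occ (gball x R) (\<lambda>_. 1) v \<le> C * occ (gball x R) (\<lambda>_. 1) x"
proof -
  obtain C where C: "C > 0" "\<And>x R. 0 < R \<Longrightarrow> max_mean_exit x R \<le> ennreal C * mean_exit x R"
    using assms by (auto simp: cond_Ebar_def)
  have nn: "0 \<le> occ (gball x R) (\<lambda>_. 1) v" for x R v by (rule occ_nonneg) auto
  have "occ (gball x R) (\<lambda>_. 1) v \<le> max 1 C * occ (gball x R) (\<lambda>_. 1) x"
    if "0 < R" "v \<in> gball x R" for x R v
  proof -
    have "mean_exit_from v x R \<le> max_mean_exit x R"
      unfolding max_mean_exit_def using that by (intro Max_ge) auto
    also have "\<dots> \<le> ennreal C * mean_exit x R" by (rule C(2)[OF that(1)])
    finally have "occ (gball x R) (\<lambda>_. 1) v \<le> C * occ (gball x R) (\<lambda>_. 1) x"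
      using C(1) nn by (simp add: mean_exit_eq mean_exit_from_eq ennreal_mult'[symmetric])
    also have "\<dots> \<le> max 1 C * occ (gball x R) (\<lambda>_. 1) x" by (intro mult_right_mono nn) auto
    finally show ?thesis .
  qed
  then show ?thesis using that[of "max 1 C"] by simp
qed

subsection \<open>Green function and hitting probabilities\<close>

text \<open>Reversibility: \<open>vertex_weight x * trans_prob x y\<close> is the symmetric edge
  weight, so averaging is self-adjoint for the weighted inner product.\<close>

lemma avg_sym:
  assumes D: "finite D" and u: "\<And>x. x \<notin> D \<Longrightarrow> u x = 0" and v: "\<And>x. x \<notin> D \<Longrightarrow> v x = 0"
  shows "(\<Sum>x\<in>D. vertex_weight x * (u x * avg v x)) = (\<Sum>x\<in>D. vertex_weight x * (v x * avg u x))"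
proof -
  define m where "m x y = (if adj x y then \<mu> x y else 0)" for x y
  have m: "vertex_weight x * trans_prob x y = m x y" for x y
    using vertex_weight_pos[of x] by (simp add: trans_prob_def m_def)
  have avg_D: "vertex_weight x * (a * avg w x) = (\<Sum>y\<in>D. m x y * (a * w y))"
    if "\<And>x. x \<notin> D \<Longrightarrow> w x = 0" for a w x
  proof -
    have "avg w x = (\<Sum>y\<in>D. trans_prob x y * w y)"
      unfolding avg_def using D that by (intro sum.mono_neutral_cong) (auto simp: trans_prob_def)
    then show ?thesis by (simp add: sum_distrib_left mult.left_commute flip: m mult.assoc)
  qed
  have "m x y = m y x" for x y using adj_sym weight_sym by (auto simp: m_def)
  then have "(\<Sum>x\<in>D. \<Sum>y\<in>D. m x y * (u x * v y)) = (\<Sum>x\<in>D. \<Sum>y\<in>D. m x y * (v x * u y))"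
    by (subst sum.swap) (simp add: mult.commute)
  then show ?thesis by (simp add: avg_D u v)
qed

text \<open>The mean number of visits to the pole \<open>a\<close> before leaving \<open>D\<close>;
  division by the weight of \<open>a\<close> makes it symmetric.\<close>

definition green :: "'a set \<Rightarrow> 'a \<Rightarrow> 'a \<Rightarrow> real" where
  "green D a v = occ D (indicator {a}) v / vertex_weight a"

lemma green_nonneg: "finite D \<Longrightarrow> 0 \<le> green D a v"
  unfolding green_def using vertex_weight_pos[of a] by (intro divide_nonneg_pos occ_nonneg) auto

lemma green_outside: "v \<notin> D \<Longrightarrow> green D a v = 0"
  by (simp add: green_def occ_outside)

lemma green_eq:
  "finite D \<Longrightarrow> v \<in> D \<Longrightarrow> green D a v = indicator {a} v / vertex_weight a + avg (green D a) v"
  using occ_eq[of D "indicator {a}" v]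
  by (simp add: green_def[abs_def] avg_divide add_divide_distrib)

lemma green_harmonic: "finite D \<Longrightarrow> v \<in> D \<Longrightarrow> v \<noteq> a \<Longrightarrow> avg (green D a) v = green D a v"
  using green_eq[of D v a] by simp

lemma green_superharmonic: "finite D \<Longrightarrow> v \<in> D \<Longrightarrow> avg (green D a) v \<le> green D a v"
  using green_eq[of D v a] vertex_weight_pos[of a] by (simp add: indicator_def)

lemma green_sym:
  assumes D: "finite D" "a \<in> D" "b \<in> D" shows "green D a b = green D b a"
proof -
  \<comment> \<open>Pairing \<open>u\<close> with the Laplacian of \<open>green D c\<close>
    evaluates \<open>u\<close> at \<open>c\<close>. For two Green functions, self-adjointness then
    gives the symmetry.\<close>
  have *: "(\<Sum>x\<in>D. vertex_weight x * (u x * (green D c x - avg (green D c) x))) = u c"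
    if "c \<in> D" for u c
  proof -
    have "(\<Sum>x\<in>D. vertex_weight x * (u x * (green D c x - avg (green D c) x))) =
        (\<Sum>x\<in>D. if x = c then u c else 0)"
      using vertex_weight_pos[of c] green_eq[OF D(1), of _ c]
      by (intro sum.cong) (auto simp: indicator_def)
    then show ?thesis using that D(1) by simp
  qed
  have "(\<Sum>x\<in>D. vertex_weight x * (green D a x * (green D b x - avg (green D b) x))) =
        (\<Sum>x\<in>D. vertex_weight x * (green D b x * (green D a x - avg (green D a) x)))"
    using avg_sym[OF D(1), of "green D a" "green D b"]
    by (simp add: green_outside algebra_simps sum_subtractf)
  then show ?thesis using *[of b "green D a"] *[of a "green D b"] D by simp
qed

text \<open>Positivity at the pole spreads along the path: superharmonicity passes at least the
  fraction \<open>p\<^sub>0\<close> on to the next vertex.\<close>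

lemma green_pos_path:
  assumes D: "finite D" "\<And>i. i \<le> k \<Longrightarrow> f i \<in> D" and f: "\<And>i. i < k \<Longrightarrow> adj (f i) (f (Suc i))"
  shows "i \<le> k \<Longrightarrow> 0 < green D (f 0) (f i)"
proof (induction i)
  case 0
  then show ?case
    using green_eq[OF D(1), of "f 0" "f 0"] D(2)[of 0] vertex_weight_pos[of "f 0"]
      avg_nonneg[of "green D (f 0)" "f 0"] green_nonneg[OF D(1)] by (simp add: add_pos_nonneg)
next
  case (Suc i)
  then have "0 < p\<^sub>0 * green D (f 0) (f i)" using p0_pos by simp
  also have "\<dots> \<le> avg (green D (f 0)) (f (Suc i))"
    using f[of i] Suc.prems adj_sym green_nonneg[OF D(1)] by (intro avg_ge_p0) auto
  also have "\<dots> \<le> green D (f 0) (f (Suc i))"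
    using D Suc.prems by (intro green_superharmonic) auto
  finally show ?case .
qed

end

section \<open>Harnack chains and comparison of Green functions\<close>

locale harnack_graph = p0_graph adj \<mu> p\<^sub>0 for adj :: "'a \<Rightarrow> 'a \<Rightarrow> bool" and \<mu> p\<^sub>0 +
  fixes C :: real
  assumes C_ge_1: "1 \<le> C"
    and harnack: "0 < R \<Longrightarrow> (\<And>v. 0 \<le> u v) \<Longrightarrow> (\<And>v. v \<in> gball x (2 * R) \<Longrightarrow> avg u v = u v) \<Longrightarrow>
      y \<in> gball x R \<Longrightarrow> z \<in> gball x R \<Longrightarrow> u y \<le> C * u z"
begin

text \<open>One Harnack step, in a ball of radius \<open>2 * m\<close>, covers \<open>m\<close>
  edges of the path and costs a factor \<open>C\<close>.\<close>

lemma harnack_chain: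
  assumes m: "0 < m" and u: "\<And>v. 0 \<le> u v"
    and f: "\<And>i. i < k \<Longrightarrow> adj (f i) (f (Suc i))"
    and harm: "\<And>i v. i \<le> k \<Longrightarrow> gdist (f i) v < 4 * m \<Longrightarrow> avg u v = u v"
    and k: "k \<le> N * m"
  shows "u (f 0) \<le> C ^ N * u (f k) \<and> u (f k) \<le> C ^ N * u (f 0)"
  using f harm k
proof (induction N arbitrary: k)
  case (Suc N)
  \<comment> \<open>Truncated subtraction gives \<open>j = 0\<close> on a piece shorter than
    \<open>m\<close>.\<close>
  define j where "j = k - m"
  have j: "j \<le> k" "j \<le> N * m" "k - j \<le> m" using Suc.prems(3) by (auto simp: j_def)
  have IH: "u (f 0) \<le> C ^ N * u (f j)" "u (f j) \<le> C ^ N * u (f 0)"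
  proof -
    have "u (f 0) \<le> C ^ N * u (f j) \<and> u (f j) \<le> C ^ N * u (f 0)"
    proof (rule Suc.IH)
      show "adj (f i) (f (Suc i))" if "i < j" for i using that j Suc.prems(1) by simp
      show "avg u v = u v" if "i \<le> j" "gdist (f i) v < 4 * m" for i v
        using that j by (intro Suc.prems(2)[of i]) auto
    qed (rule j)
    then show "u (f 0) \<le> C ^ N * u (f j)" "u (f j) \<le> C ^ N * u (f 0)" by auto
  qed
  have "gdist (f k) (f j) < 2 * m"
    using gdist_path[of k f j k] Suc.prems(1) j m gdist_sym[of "f k" "f j"] by auto
  then have "u (f i) \<le> C * u (f i')" if "i \<in> {j, k}" "i' \<in> {j, k}" for i i'
    using that m Suc.prems(2)[of k] u
    by (intro harnack[of "2 * real m" u "f k"]) (auto simp: gball_def)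
  then have H: "u (f j) \<le> C * u (f k)" "u (f k) \<le> C * u (f j)" by auto
  have "u (f 0) \<le> C ^ N * (C * u (f k))"
    using IH(1) H(1) C_ge_1 by (meson mult_left_mono order_trans zero_le_power zero_le_one)
  moreover have "u (f k) \<le> C * (C ^ N * u (f 0))"
    using IH(2) H(2) C_ge_1 by (meson mult_left_mono order_trans zero_le_one)
  ultimately show ?case by (simp add: mult_ac)
qed simp

lemma green_transfer:
  assumes D: "finite D" "\<And>v. gdist c v < 36 * m \<Longrightarrow> v \<in> D" and m: "0 < m"
    and y: "gdist c y = 16 * m" and z: "gdist c z = 16 * m" and yz: "8 * m \<le> gdist y z"
  shows "green D y c \<le> C ^ 16 * green D y z \<and> green D y z \<le> C ^ 16 * green D y c"
proof -
  obtain f where f: "f 0 = c" "f (16 * m) = z" "\<And>i. i < 16 * m \<Longrightarrow> adj (f i) (f (Suc i))"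
    "\<And>i. i \<le> 16 * m \<Longrightarrow> gdist c (f i) = i" "\<And>i. i \<le> 16 * m \<Longrightarrow> gdist (f i) z = 16 * m - i"
    using geodesic[of c z] z by metis
  have harm: "avg (green D y) v = green D y v" if "i \<le> 16 * m" "gdist (f i) v < 4 * m" for i v
  proof (rule green_harmonic[OF D(1)])
    show "v \<in> D" using D(2)[of v] gdist_triangle[of c v "f i"] f(4)[OF that(1)] that by simp
    \<comment> \<open>Points of the geodesic keep distance at least \<open>4 * m\<close> from
      \<open>y\<close>: a closer one would need \<open>i > 12 * m\<close> by the distances from
      \<open>c\<close> and \<open>i < 12 * m\<close> by those to \<open>z\<close>.\<close>
    show "v \<noteq> y"
    proof
      assume "v = y"
      then have "gdist (f i) y < 4 * m" using that(2) by simp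
      then show False
        using gdist_triangle[of c y "f i"] gdist_triangle[of y z "f i"] gdist_sym[of y "f i"]
          f(4)[OF that(1)] f(5)[OF that(1)] that(1) y yz by linarith
    qed
  qed
  show ?thesis
    using harnack_chain[of m "green D y" "16 * m" f 16] m f(1-3) harm green_nonneg[OF D(1)] by simp
qed

text \<open>
  If \<open>y\<close> and \<open>z\<close> are far apart, the value \<open>green D y z\<close> is compared with \<open>green D y c\<close> along a
  geodesic from \<open>c\<close> to \<open>z\<close>, which avoids \<open>y\<close>, and with \<open>green D z c\<close> along one from \<open>c\<close> to \<open>y\<close>.
\<close>

lemma green_sphere:
  assumes D: "finite D" "\<And>v. gdist c v < 36 * m \<Longrightarrow> v \<in> D" and m: "0 < m"
    and y: "gdist c y = 16 * m" and z: "gdist c z = 16 * m"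
  shows "green D c y \<le> C ^ 32 * green D c z"
proof (cases "gdist y z < 8 * m")
  case True
  \<comment> \<open>One Harnack step around \<open>y\<close>: the doubled ball has radius
    \<open>16 * m\<close> and just misses the pole \<open>c\<close>.\<close>
  have "green D c y \<le> C * green D c z"
  proof (rule harnack[of "8 * real m" "green D c" y])
    fix v assume "v \<in> gball y (2 * (8 * real m))"
    then have v: "gdist y v < 16 * m" by (simp add: gball_def)
    then have "gdist c v < 36 * m" using gdist_triangle[of c v y] y by simp
    moreover have "v \<noteq> c" using v y gdist_sym[of c y] by auto
    ultimately show "avg (green D c) v = green D c v" using D by (intro green_harmonic) auto
  qed (use True m green_nonneg[OF D(1)] in \<open>auto simp: gball_def\<close>)
  also have "\<dots> \<le> C ^ 32 * green D c z"
    using C_ge_1 green_nonneg[OF D(1)] by (intro mult_right_mono self_le_power) auto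
  finally show ?thesis .
next
  case False
  have inD: "c \<in> D" "y \<in> D" "z \<in> D" using D(2) y z m by auto
  have yz: "8 * m \<le> gdist y z" "8 * m \<le> gdist z y" using False gdist_sym[of y z] by auto
  have "green D y c \<le> C ^ 16 * green D y z"
    using green_transfer[OF D m y z yz(1)] by blast
  also have "green D y z = green D z y" using inD D by (intro green_sym)
  also have "C ^ 16 * green D z y \<le> C ^ 16 * (C ^ 16 * green D z c)"
    using green_transfer[OF D m z y yz(2)] C_ge_1 by (intro mult_left_mono) auto
  also have "\<dots> = C ^ 32 * green D z c" by (simp add: power_add[symmetric] flip: mult.assoc)
  finally show ?thesis using inD D(1) by (simp add: green_sym[of D c])
qed

text \<open>\<open>green_sphere\<close> moves \<open>a\<close> to the point where the geodesic from
  \<open>c\<close> to \<open>w\<close> crosses the sphere; a chain of at most \<open>80 * m\<close>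
  edges then leads outwards to \<open>w\<close>. Hence the exponent \<open>32 + 80\<close>, and the
  radius \<open>96 * m + 4 * m\<close> for the Harnack balls.\<close>

lemma green_radial:
  assumes D: "finite D" "\<And>v. gdist c v < 100 * m \<Longrightarrow> v \<in> D" and m: "0 < m"
    and a: "gdist c a = 16 * m" and w: "16 * m \<le> gdist c w" "gdist c w \<le> 96 * m"
  shows "green D c a \<le> C ^ 112 * green D c w"
proof -
  obtain f where f: "f 0 = c" "f (gdist c w) = w" "\<And>i. i < gdist c w \<Longrightarrow> adj (f i) (f (Suc i))"
    "\<And>i. i \<le> gdist c w \<Longrightarrow> gdist c (f i) = i"
    using geodesic[of c w] by metis
  define g where "g i = f (16 * m + i)" for i
  define k where "k = gdist c w - 16 * m"
  have gk: "g k = w" using f(2) w by (simp add: g_def k_def)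
  have g: "gdist c (g i) = 16 * m + i" if "i \<le> k" for i
    using that w f(4)[of "16 * m + i"] by (simp add: g_def k_def)
  have harm: "avg (green D c) v = green D c v" if "i \<le> k" "gdist (g i) v < 4 * m" for i v
  proof (rule green_harmonic[OF D(1)])
    show "v \<in> D"
      using D(2)[of v] gdist_triangle[of c v "g i"] g[OF that(1)] that w by (simp add: k_def)
    show "v \<noteq> c"
      using gdist_sym[of c "g i"] g[OF that(1)] that by auto
  qed
  have "green D c a \<le> C ^ 32 * green D c (g 0)"
    using D m a g[of 0] by (intro green_sphere) auto
  also have "\<dots> \<le> C ^ 32 * (C ^ 80 * green D c (g k))"
    using harnack_chain[of m "green D c" k g 80] m f(3) harm green_nonneg[OF D(1)] w C_ge_1
    by (intro mult_left_mono) (auto simp: g_def k_def)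
  also have "\<dots> = C ^ 112 * green D c w" by (simp add: gk power_add[symmetric] flip: mult.assoc)
  finally show ?thesis .
qed

text \<open>
  The witness \<open>h\<close> is a multiple of the Green function, replaced by \<open>1\<close> on the target. It stays
  subharmonic off the target, as the target is entered through its sphere, where that multiple
  is at most \<open>1\<close>.
\<close>

lemma hitting_lower_bound:
  assumes D: "finite D" "\<And>v. gdist c v < 100 * m \<Longrightarrow> v \<in> D" and m: "0 < m"
    and w: "16 * m \<le> gdist c w"
  obtains h where "\<And>v. 0 \<le> h v" "\<And>v. h v \<le> 1" "\<And>v. v \<notin> D \<Longrightarrow> h v = 0"
    "\<And>v. v \<in> D \<Longrightarrow> 16 * m < gdist c v \<Longrightarrow> h v \<le> avg h v"
    "\<And>v. 16 * m \<le> gdist c v \<Longrightarrow> gdist c v \<le> 96 * m \<Longrightarrow> 1 / C ^ 112 \<le> h v"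
proof -
  define S where "S = {a. gdist c a = 16 * m}"
  define M where "M = Max (green D c ` S)"
  obtain f where f: "f 0 = c" "\<And>i. i < gdist c w \<Longrightarrow> adj (f i) (f (Suc i))"
    "\<And>i. i \<le> gdist c w \<Longrightarrow> gdist c (f i) = i"
    using geodesic[of c w] by metis
  have "S \<subseteq> D" using D(2) m by (auto simp: S_def)
  then have S: "finite S" using D(1) finite_subset by blast
  \<comment> \<open>The geodesic to \<open>w\<close> crosses the sphere, so \<open>S\<close> is
    non-empty and \<open>M\<close> is attained.\<close>
  have fS: "f (16 * m) \<in> S" using f(3) w by (simp add: S_def)
  have "0 < green D (f 0) (f (16 * m))"
    using D m w f by (intro green_pos_path[of D "16 * m"]) auto
  also have "\<dots> \<le> M" unfolding M_def using S fS f(1) by (intro Max_ge) auto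
  finally have M: "0 < M" .
  have M_ge: "green D c a \<le> M" if "a \<in> S" for a unfolding M_def using S that by (intro Max_ge) auto
  have "M \<in> green D c ` S" unfolding M_def using S fS by (intro Max_in) auto
  then obtain a where a: "gdist c a = 16 * m" "M = green D c a" by (auto simp: S_def)
  define h where "h v = (if gdist c v \<le> 16 * m then 1 else green D c v / M)" for v
  have sub: "h v \<le> avg h v" if v: "v \<in> D" "16 * m < gdist c v" for v
  proof -
    have "v \<noteq> c" using v(2) by auto
    then have "h v = avg (green D c) v / M"
      using v green_harmonic[of D v c] D(1) by (simp add: h_def)
    also have "\<dots> = avg (\<lambda>z. green D c z / M) v" by (simp add: avg_divide)
    also have "\<dots> \<le> avg h v"
    proof (rule avg_mono)
      fix z assume "adj v z"
      then have "gdist c v \<le> gdist c z + 1"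
        using gdist_triangle[of c v z] gdist_adj[of v z] gdist_sym[of z v] by simp
      then have "gdist c z \<le> 16 * m \<Longrightarrow> z \<in> S" using v(2) by (simp add: S_def)
      then show "green D c z / M \<le> h z" using M M_ge by (simp add: h_def)
    qed
    finally show ?thesis .
  qed
  have "h v \<le> 1" for v
  \<comment> \<open>Inside \<open>D\<close> and off the target, \<open>h\<close> is subharmonic;
    elsewhere it is \<open>0\<close> or \<open>1\<close>.\<close>
  proof (rule maximum_principle[of "D - {v. gdist c v \<le> 16 * m}"])
    show "finite (D - {v. gdist c v \<le> 16 * m})" using D(1) by simp
    show "h v \<le> avg h v" if "v \<in> D - {v. gdist c v \<le> 16 * m}" for v
      using that by (intro sub) auto
    show "h v \<le> 1" if "v \<notin> D - {v. gdist c v \<le> 16 * m}" for v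
      using that by (cases "gdist c v \<le> 16 * m") (auto simp: h_def green_outside)
  qed
  moreover have "0 \<le> h v" for v using green_nonneg[OF D(1)] M by (simp add: h_def)
  moreover have "h v = 0" if "v \<notin> D" for v
  proof -
    have "\<not> gdist c v < 100 * m" using D(2) that by blast
    then have "\<not> gdist c v \<le> 16 * m" using m by linarith
    then show ?thesis using that by (simp add: h_def green_outside)
  qed
  moreover have "1 / C ^ 112 \<le> h v" if v: "16 * m \<le> gdist c v" "gdist c v \<le> 96 * m" for v
  proof -
    have C1: "1 \<le> C ^ 112" using C_ge_1 by (rule one_le_power)
    then have C0: "0 < C ^ 112" by linarith
    have "M \<le> C ^ 112 * green D c v" unfolding a(2) using green_radial[OF D m a(1) v] .
    then have "1 / C ^ 112 \<le> green D c v / M" using M C0 by (simp add: field_simps)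
    moreover have "1 / C ^ 112 \<le> 1" using C0 C1 by (simp only: divide_le_eq_1_pos)
    ultimately show ?thesis by (simp only: h_def split: if_split) blast
  qed
  ultimately show ?thesis using that sub by blast
qed

end

subsection \<open>Lower bound\<close>

context p0_graph
begin

section \<open>Leaving a ball along a prescribed path\<close>

lemma exit_prob_nonneg: "0 \<le> 1 - stay D n v"
  using stay_le_1[of D n v] by simp

lemma p0_le_1: "p\<^sub>0 \<le> 1"
proof -
  obtain x y where "adj x y" using exists_adj by blast
  then show ?thesis using avg_ge_p0[of "\<lambda>_. 1" x y] by simp
qed

text \<open>Induction from the end of the path, each edge costing a factor \<open>p\<^sub>0\<close>.
  The horizon is \<open>Suc k\<close> because an exit at time \<open>k\<close> must come strictly
  before it.\<close>

lemma exit_prob_path: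
  assumes f: "\<And>i. i < k \<Longrightarrow> adj (f i) (f (Suc i))" and out: "f k \<notin> B"
  shows "p\<^sub>0 ^ k \<le> 1 - stay B (Suc k) (f 0)"
proof -
  have "p\<^sub>0 ^ i \<le> 1 - stay B (Suc i) (f (k - i))" if "i \<le> k" for i
    using that
  proof (induction i)
    case 0
    then show ?case using out by simp
  next
    case (Suc i)
    show ?case
    proof (cases "f (k - Suc i) \<in> B")
      case True
      have "adj (f (k - Suc i)) (f (k - i))" using f[of "k - Suc i"] Suc.prems by (simp add: Suc_diff_Suc)
      then have "p\<^sub>0 * (1 - stay B (Suc i) (f (k - i))) \<le> avg (\<lambda>v. 1 - stay B (Suc i) v) (f (k - Suc i))"
        by (intro avg_ge_p0 exit_prob_nonneg)
      also have "\<dots> = 1 - stay B (Suc (Suc i)) (f (k - Suc i))"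
        using True by (simp add: avg_linear del: stay.simps(2)) simp
      finally have "p\<^sub>0 * (1 - stay B (Suc i) (f (k - i))) \<le> 1 - stay B (Suc (Suc i)) (f (k - Suc i))" .
      moreover have "p\<^sub>0 ^ Suc i \<le> p\<^sub>0 * (1 - stay B (Suc i) (f (k - i)))"
        unfolding power_Suc using Suc.IH Suc.prems p0_pos by (intro mult_left_mono) linarith+
      ultimately show ?thesis by linarith
    next
      case False
      then show ?thesis using p0_le_1 p0_pos power_le_one[of p\<^sub>0 "Suc i"] by (simp del: power_Suc)
    qed
  qed
  from this[of k] show ?thesis by simp
qed

lemma finite_gsphere: "finite (gsphere x R)"
proof -
  have "gsphere x R \<subseteq> gball x (R + 1)" by (auto simp: gsphere_def gball_def)
  then show ?thesis using finite_gball finite_subset by blast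
qed

lemma finite_geodesic_hull: "finite (geodesic_hull x y)"
proof -
  have "geodesic_hull x y \<subseteq> {v. gdist x v \<le> gdist x y}"
  proof
    fix v assume "v \<in> geodesic_hull x y"
    then obtain p where p: "p \<noteq> []" "hd p = x" "successively adj p" "length p = Suc (gdist x y)" "v \<in> set p"
      by (auto simp: geodesic_hull_def path_between_def)
    then obtain i where i: "i < length p" "v = p ! i" by (auto simp: in_set_conv_nth)
    have "gdist (p ! 0) (p ! i) \<le> i - 0"
      by (rule gdist_path[of "gdist x y"]) (use p i in \<open>auto simp: successively_conv_nth\<close>)
    then show "v \<in> {v. gdist x v \<le> gdist x y}" using p i by (simp add: hd_conv_nth)
  qed
  then show ?thesis using finite_closed_ball finite_subset by blast
qed

text \<open>The geodesic to \<open>y\<close> supplies a path long enough to leave the ball after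
  \<open>nat \<lceil>R\<rceil>\<close> steps.\<close>

lemma exit_prob_ge_power:
  assumes R: "0 < R" and y: "real (gdist x y) = 2 * R" and n: "\<lceil>R\<rceil> < int n"
  shows "p\<^sub>0 ^ nat \<lceil>R\<rceil> \<le> 1 - stay (gball x R) n x"
proof -
  obtain f where f: "f 0 = x" "\<And>i. i < gdist x y \<Longrightarrow> adj (f i) (f (Suc i))"
    "\<And>i. i \<le> gdist x y \<Longrightarrow> gdist x (f i) = i"
    using geodesic[of x y] by metis
  have k: "nat \<lceil>R\<rceil> \<le> gdist x y"
  proof -
    have "R \<le> real (gdist x y)" using y R by simp
    then show ?thesis by linarith
  qed
  have "p\<^sub>0 ^ nat \<lceil>R\<rceil> \<le> 1 - stay (gball x R) (Suc (nat \<lceil>R\<rceil>)) (f 0)"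
  proof (rule exit_prob_path)
    have "R \<le> real (nat \<lceil>R\<rceil>)" using R by linarith
    then show "f (nat \<lceil>R\<rceil>) \<notin> gball x R" using f(3)[OF k] by (simp add: gball_def)
    show "adj (f i) (f (Suc i))" if "i < nat \<lceil>R\<rceil>" for i
      using that k by (intro f(2)) linarith
  qed
  also have "\<dots> \<le> 1 - stay (gball x R) n x"
  proof -
    have "Suc (nat \<lceil>R\<rceil>) \<le> n" using n R by linarith
    then show ?thesis using stay_antimono f(1) by (simp del: stay.simps)
  qed
  finally show ?thesis .
qed

end

context harnack_graph
begin

section \<open>Passing from one ball to the next\<close>

definition hit_const :: real where "hit_const = C ^ 112"

text \<open>Chosen so that \<open>C / exit_const = 1 / (4 * hit_const)\<close>: the two time
  corrections of a stage then use up half of the hitting probability.\<close>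

definition exit_const :: real where "exit_const = 4 * C * hit_const"

lemma hit_const_ge_1: "1 \<le> hit_const"
  unfolding hit_const_def using C_ge_1 by (rule one_le_power)

lemma exit_const_ge_4: "4 \<le> exit_const"
  unfolding exit_const_def using C_ge_1 hit_const_ge_1 mult_mono[of 1 C 1 hit_const] by simp

lemma C_div_exit_const: "C / exit_const = 1 / (4 * hit_const)"
  unfolding exit_const_def using C_ge_1 by simp

text \<open>
  The Harnack inequality gives no control on \<open>occ D (\<lambda>_. 1)\<close> away from the centre of \<open>D\<close>. The
  mean time after the walk has reached \<open>gball c (16 * m)\<close> is therefore split into the time
  spent in \<open>gball c (40 * m)\<close>, which is harmonic near \<open>z\<close>, and the time spent outside, which is
  harmonic near \<open>c\<close>.
\<close>

lemma exit_prob_stage: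
  assumes m: "0 < m" and zc: "gdist z c = 80 * m"
    and Ez: "occ (gball z (300 * real m)) (\<lambda>_. 1) z \<le> E"
    and Ec: "occ (gball c (200 * real m)) (\<lambda>_. 1) c \<le> E"
    and b: "0 \<le> b" "b \<le> 1" and t: "0 < t" and s: "2 * hit_const * exit_const * E \<le> real s"
    and IH: "\<And>a. gdist c a \<le> 16 * m \<Longrightarrow>
      b * (1 - occ (gball c (200 * real m)) (\<lambda>_. 1) a / (exit_const * E)) \<le> 1 - stay B t a"
    and w: "gdist z w \<le> 16 * m"
  shows "b / (2 * hit_const) * (1 - occ (gball z (200 * real m)) (\<lambda>_. 1) w / (exit_const * E))
    \<le> 1 - stay B (t + s) w"
proof -
  \<comment> \<open>The radii fit: \<open>80 + 200 \<le> 300\<close> gives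
    \<open>D' \<subseteq> D\<^sub>1\<close>, and the balls of radius \<open>34 * m\<close> in which
    harmonicity is required lie inside \<open>N\<close> around \<open>c\<close> and miss
    \<open>N\<close> around \<open>z\<close>, as \<open>34 + 40 \<le> 80\<close>.\<close>
  define N where "N = gball c (40 * real m)"
  define D where "D = gball z (200 * real m)"
  define D' where "D' = gball c (200 * real m)"
  define D\<^sub>1 where "D\<^sub>1 = gball z (300 * real m)"
  define e\<^sub>1 where "e\<^sub>1 = occ D\<^sub>1 (indicator N)"
  define e\<^sub>2 where "e\<^sub>2 = occ D' (indicator (- N))"
  have fin: "finite D" "finite D'" "finite D\<^sub>1" by (simp_all add: D_def D'_def D\<^sub>1_def)
  note balls = N_def D_def D'_def D\<^sub>1_def gball_def
  have "z \<in> D\<^sub>1" using m by (simp add: balls)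
  then have E1: "1 \<le> E" using occ_ge_1[OF fin(3)] Ez by (fastforce simp: D\<^sub>1_def)
  have K: "1 \<le> hit_const" and M: "4 \<le> exit_const" by (rule hit_const_ge_1 exit_const_ge_4)+
  have ME: "0 < exit_const * E" using E1 M by simp
  have e\<^sub>1_nonneg: "0 \<le> e\<^sub>1 v" for v unfolding e\<^sub>1_def using fin by (intro occ_nonneg) auto
  have e\<^sub>2_nonneg: "0 \<le> e\<^sub>2 v" for v unfolding e\<^sub>2_def using fin by (intro occ_nonneg) auto
  have "D' \<subseteq> D\<^sub>1"
  proof
    fix v assume "v \<in> D'"
    then show "v \<in> D\<^sub>1" using gdist_triangle[of z v c] zc by (simp add: balls)
  qed
  have split: "occ D' (\<lambda>_. 1) v \<le> e\<^sub>1 v + e\<^sub>2 v" for v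
  proof -
    have "(\<lambda>_. 1) = (\<lambda>v. indicator N v + indicator (- N) v :: real)" by (auto simp: indicator_def)
    then have "occ D' (\<lambda>_. 1) v = occ D' (indicator N) v + e\<^sub>2 v"
      using occ_add[OF fin(2), of "indicator N" "indicator (- N)" v] by (simp add: e\<^sub>2_def)
    also have "occ D' (indicator N) v \<le> e\<^sub>1 v"
      unfolding e\<^sub>1_def using fin(3) \<open>D' \<subseteq> D\<^sub>1\<close> by (intro occ_mono) auto
    finally show ?thesis by simp
  qed
  have e\<^sub>2: "e\<^sub>2 a \<le> C * E" if a: "gdist c a \<le> 16 * m" for a
  proof -
    have "e\<^sub>2 a \<le> C * e\<^sub>2 c"
    proof (rule harnack[of "17 * real m" e\<^sub>2 c])
      fix v assume "v \<in> gball c (2 * (17 * real m))"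
      then have "v \<in> D'" "v \<in> N" by (auto simp: balls)
      then show "avg e\<^sub>2 v = e\<^sub>2 v" unfolding e\<^sub>2_def using occ_eq[OF fin(2), of "indicator (- N)" v] by simp
    qed (use m a e\<^sub>2_nonneg in \<open>auto simp: gball_def\<close>)
    also have "e\<^sub>2 c \<le> occ D' (\<lambda>_. 1) c"
      unfolding e\<^sub>2_def using fin by (intro occ_mono) (auto simp: indicator_def)
    finally show ?thesis using Ec C_ge_1 by (simp add: D'_def mult_left_mono order_trans)
  qed
  have e\<^sub>1: "e\<^sub>1 w \<le> C * E"
  proof -
    have "e\<^sub>1 w \<le> C * e\<^sub>1 z"
    proof (rule harnack[of "17 * real m" e\<^sub>1 z])
      fix v assume "v \<in> gball z (2 * (17 * real m))"
      then have v: "real (gdist z v) < 34 * real m" by (simp add: gball_def)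
      then have "v \<in> D\<^sub>1" "v \<notin> N"
        using gdist_triangle[of z c v] zc gdist_sym[of v c] by (auto simp: balls)
      then show "avg e\<^sub>1 v = e\<^sub>1 v" unfolding e\<^sub>1_def using occ_eq[OF fin(3), of "indicator N" v] by simp
    qed (use m w e\<^sub>1_nonneg in \<open>auto simp: gball_def\<close>)
    also have "e\<^sub>1 z \<le> occ D\<^sub>1 (\<lambda>_. 1) z"
      unfolding e\<^sub>1_def using fin by (intro occ_mono) (auto simp: indicator_def)
    finally show ?thesis using Ez C_ge_1 by (simp add: D\<^sub>1_def mult_left_mono order_trans)
  qed
  have inD: "v \<in> D" if "gdist c v < 100 * m" for v
    using that gdist_triangle[of z v c] zc by (simp add: balls)
  have far: "16 * m \<le> gdist c z" using zc gdist_sym[of c z] by simp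
  obtain h where h: "\<And>v. 0 \<le> h v" "\<And>v. h v \<le> 1" "\<And>v. v \<notin> D \<Longrightarrow> h v = 0"
    "\<And>v. v \<in> D \<Longrightarrow> 16 * m < gdist c v \<Longrightarrow> h v \<le> avg h v"
    "\<And>v. 16 * m \<le> gdist c v \<Longrightarrow> gdist c v \<le> 96 * m \<Longrightarrow> 1 / hit_const \<le> h v"
    by (rule hitting_lower_bound[of D c m z, OF fin(1) inD m far], assumption) (rule that[unfolded hit_const_def])
  \<comment> \<open>The loss \<open>C / exit_const\<close> pays for \<open>e\<^sub>2\<close>, which
    is at most \<open>C * E\<close> on the target.\<close>
  define \<gamma> where "\<gamma> = 1 - C / exit_const"
  have \<gamma>: "0 \<le> \<gamma>" "\<gamma> \<le> 1" unfolding \<gamma>_def C_div_exit_const using K by (auto simp: field_simps)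
  \<comment> \<open>A subsolution: at most the given exit probability on the target, nonpositive off
    \<open>D\<close>, and subharmonic in between, as \<open>e\<^sub>1\<close> is
    superharmonic.\<close>
  define \<alpha> where "\<alpha> v = b * (h v * \<gamma> - e\<^sub>1 v / (exit_const * E))" for v
  have h\<gamma>: "h v * \<gamma> \<le> \<gamma>" "0 \<le> h v * \<gamma>" for v
    using h(1,2)[of v] \<gamma> mult_right_mono[of "h v" 1 \<gamma>] by auto
  have e\<^sub>1_div: "0 \<le> e\<^sub>1 v / (exit_const * E)" for v using e\<^sub>1_nonneg ME by simp
  have \<alpha>_le: "\<alpha> v \<le> b" for v
  proof -
    have "h v * \<gamma> - e\<^sub>1 v / (exit_const * E) \<le> 1" using h\<gamma>[of v] \<gamma> e\<^sub>1_div[of v] by linarith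
    then show ?thesis unfolding \<alpha>_def using b mult_left_mono[of _ 1 b] by simp
  qed
  have \<alpha>_out: "\<alpha> v \<le> 0" if "v \<notin> D" for v
    using mult_nonneg_nonneg[OF b(1) e\<^sub>1_div[of v]] by (simp add: \<alpha>_def h(3)[OF that])
  have \<alpha>_target: "\<alpha> a \<le> 1 - stay B t a" if a: "gdist c a \<le> 16 * m" for a
  proof -
    have "occ D' (\<lambda>_. 1) a / (exit_const * E) \<le> (e\<^sub>1 a + C * E) / (exit_const * E)"
      using split[of a] e\<^sub>2[OF a] ME by (intro divide_right_mono) auto
    also have "\<dots> = e\<^sub>1 a / (exit_const * E) + C / exit_const"
      using E1 by (simp add: add_divide_distrib)
    finally have "h a * \<gamma> - e\<^sub>1 a / (exit_const * E) \<le> 1 - occ D' (\<lambda>_. 1) a / (exit_const * E)"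
      using h\<gamma>(1)[of a] by (simp add: \<gamma>_def)
    then have "\<alpha> a \<le> b * (1 - occ D' (\<lambda>_. 1) a / (exit_const * E))"
      unfolding \<alpha>_def using b by (intro mult_left_mono)
    then show ?thesis using IH[OF a] by (simp add: D'_def)
  qed
  have \<alpha>_sub: "\<alpha> v \<le> avg \<alpha> v" if v: "v \<in> D" "16 * m < gdist c v" for v
  proof -
    have "v \<in> D\<^sub>1" using v(1) by (simp add: balls)
    then have "avg e\<^sub>1 v \<le> e\<^sub>1 v"
      unfolding e\<^sub>1_def using fin by (intro occ_superharmonic) auto
    then have "h v * \<gamma> - e\<^sub>1 v / (exit_const * E) \<le> avg h v * \<gamma> - avg e\<^sub>1 v / (exit_const * E)"
      using h(4)[OF v] \<gamma> ME by (intro diff_mono mult_right_mono divide_right_mono) auto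
    then have "\<alpha> v \<le> b * (avg h v * \<gamma> - avg e\<^sub>1 v / (exit_const * E))"
      unfolding \<alpha>_def using b by (intro mult_left_mono)
    also have "\<dots> = avg \<alpha> v"
      unfolding \<alpha>_def[abs_def] avg_cmult avg_diff avg_divide using avg_cmult[of \<gamma> h v] by (simp add: mult.commute)
    finally show ?thesis .
  qed
  \<comment> \<open>Comparison by induction on the elapsed time. The term
    \<open>b * stay D k v\<close> covers trajectories still in \<open>D\<close> at the horizon,
    where only \<open>\<alpha> \<le> b\<close> is known.\<close>
  have main: "\<alpha> v - b * stay D k v \<le> 1 - stay B (t + k) v" for k v
  proof (induction k arbitrary: v)
    case 0
    then show ?case using \<alpha>_le[of v] stay_le_1[of B t v] by simp
  next
    case (Suc k)
    have bs: "0 \<le> b * stay D (Suc k) v" using b stay_nonneg by (intro mult_nonneg_nonneg)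
    consider "gdist c v \<le> 16 * m" | "v \<notin> D" | "v \<notin> B" | "v \<in> D" "16 * m < gdist c v" "v \<in> B"
      by linarith
    then show ?case
    proof cases
      case 1
      then show ?thesis
        using \<alpha>_target[OF 1] bs stay_antimono[of t "t + Suc k" B v] by linarith
    next
      case 2
      then show ?thesis using \<alpha>_out[OF 2] bs stay_le_1[of B "t + Suc k" v] by linarith
    next
      case 3
      then show ?thesis using \<alpha>_le[of v] b bs stay_outside[OF 3, of "t + Suc k"] by linarith
    next
      case 4
      have "\<alpha> v - b * stay D (Suc k) v \<le> avg \<alpha> v - b * avg (stay D k) v"
        using \<alpha>_sub[OF 4(1,2)] 4(1) by simp
      also have "\<dots> = avg (\<lambda>u. \<alpha> u - b * stay D k u) v" by (simp add: avg_linear)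
      also have "\<dots> \<le> avg (\<lambda>u. 1 - stay B (t + k) u) v" by (intro avg_mono Suc)
      also have "\<dots> = 1 - stay B (t + Suc k) v" using 4(3) by (simp add: avg_linear)
      finally show ?thesis .
    qed
  qed
  have cw: "16 * m \<le> gdist c w" "gdist c w \<le> 96 * m"
    using gdist_triangle[of z c w] gdist_triangle[of c w z] zc gdist_sym[of c z] gdist_sym[of c w] w
    by linarith+
  have "0 < 2 * hit_const * exit_const * E" using K M E1 by simp
  then have s0: "0 < real s" using s by linarith
  \<comment> \<open>The size of \<open>s\<close> turns Markov's inequality into the correction term
    of the conclusion.\<close>
  have "stay D s w \<le> occ D (\<lambda>_. 1) w / real s"
    using stay_le_occ[OF fin(1), of s w] s0 by (simp add: field_simps)
  also have "\<dots> \<le> occ D (\<lambda>_. 1) w / (2 * hit_const * exit_const * E)"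
    using mult_pos_pos[OF s0 \<open>0 < 2 * hit_const * exit_const * E\<close>]
    by (intro divide_left_mono s occ_nonneg fin) auto
  also have "\<dots> = 1 / (2 * hit_const) * (occ D (\<lambda>_. 1) w / (exit_const * E))" by simp
  finally have st: "stay D s w \<le> 1 / (2 * hit_const) * (occ D (\<lambda>_. 1) w / (exit_const * E))" .
  have "e\<^sub>1 w / (exit_const * E) \<le> C * E / (exit_const * E)"
    using e\<^sub>1 ME by (intro divide_right_mono) auto
  also have "\<dots> = 1 / (4 * hit_const)" using E1 by (simp add: C_div_exit_const)
  finally have ew: "e\<^sub>1 w / (exit_const * E) \<le> 1 / (4 * hit_const)" .
  have "h w * (1 / (4 * hit_const)) \<le> 1 / (4 * hit_const)"
    using h(2)[of w] K mult_right_mono[of "h w" 1 "1 / (4 * hit_const)"] by simp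
  then have "1 / hit_const - 1 / (4 * hit_const) \<le> h w * \<gamma>"
    using h(5)[OF cw] by (simp add: \<gamma>_def C_div_exit_const right_diff_distrib)
  \<comment> \<open>Of \<open>1 / hit_const\<close>, a quarter is lost to \<open>\<gamma>\<close>
    and a quarter to \<open>e\<^sub>1\<close>.\<close>
  moreover have "1 / hit_const - 1 / (4 * hit_const) - 1 / (4 * hit_const) = 1 / (2 * hit_const)"
    using K by (simp add: field_simps)
  ultimately have "1 / (2 * hit_const) - stay D s w \<le> h w * \<gamma> - e\<^sub>1 w / (exit_const * E) - stay D s w"
    using ew by linarith
  then have "1 / (2 * hit_const) * (1 - occ D (\<lambda>_. 1) w / (exit_const * E))
      \<le> h w * \<gamma> - e\<^sub>1 w / (exit_const * E) - stay D s w"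
    using st unfolding right_diff_distrib by linarith
  then have "b * (1 / (2 * hit_const) * (1 - occ D (\<lambda>_. 1) w / (exit_const * E)))
      \<le> b * (h w * \<gamma> - e\<^sub>1 w / (exit_const * E) - stay D s w)"
    using b by (intro mult_left_mono)
  also have "\<dots> = \<alpha> w - b * stay D s w" by (simp add: \<alpha>_def algebra_simps)
  also have "\<dots> \<le> 1 - stay B (t + s) w" by (rule main)
  finally show ?thesis by (simp add: D_def)
qed

text \<open>Stages are composed backwards from the last ball, which lies wholly outside
  \<open>B\<close>; each takes \<open>s\<close> steps and a factor \<open>2 * hit_const\<close>. The
  extra time unit registers that the last ball is outside.\<close>

lemma exit_prob_chain:
  assumes m: "0 < m" and g: "\<And>i. i < J \<Longrightarrow> gdist (g i) (g (Suc i)) = 80 * m"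
    and E: "\<And>i. i \<le> J \<Longrightarrow> occ (gball (g i) (300 * real m)) (\<lambda>_. 1) (g i) \<le> E"
    and s: "2 * hit_const * exit_const * E \<le> real s"
    and out: "\<And>a. gdist (g J) a \<le> 16 * m \<Longrightarrow> a \<notin> B"
  shows "(1 / (2 * hit_const)) ^ J / 2 \<le> 1 - stay B (1 + J * s) (g 0)"
proof -
  have E200: "occ (gball (g i) (200 * real m)) (\<lambda>_. 1) (g i) \<le> E" if "i \<le> J" for i
  proof -
    have "occ (gball (g i) (200 * real m)) (\<lambda>_. 1) (g i) \<le> occ (gball (g i) (300 * real m)) (\<lambda>_. 1) (g i)"
      by (intro occ_mono finite_gball) (auto simp: gball_def)
    then show ?thesis using E[OF that] by simp
  qed
  have K: "1 \<le> hit_const" and M: "4 \<le> exit_const" by (rule hit_const_ge_1 exit_const_ge_4)+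
  have "1 \<le> occ (gball (g 0) (200 * real m)) (\<lambda>_. 1) (g 0)" using m by (intro occ_ge_1 finite_gball) (simp add: gball_def)
  then have E1: "1 \<le> E" using E200[of 0] by simp
  have "(1 / (2 * hit_const)) ^ j * (1 - occ (gball (g (J - j)) (200 * real m)) (\<lambda>_. 1) w / (exit_const * E))
      \<le> 1 - stay B (1 + j * s) w" if "j \<le> J" "gdist (g (J - j)) w \<le> 16 * m" for j w
    using that
  proof (induction j arbitrary: w)
    case 0
    have "0 \<le> occ (gball (g J) (200 * real m)) (\<lambda>_. 1) w / (exit_const * E)"
      using M E1 by (intro divide_nonneg_nonneg occ_nonneg) auto
    then show ?case using out[of w] 0 by simp
  next
    case (Suc j)
    have J: "Suc (J - Suc j) = J - j" using Suc.prems by simp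
    have "(1 / (2 * hit_const)) ^ j / (2 * hit_const) *
        (1 - occ (gball (g (J - Suc j)) (200 * real m)) (\<lambda>_. 1) w / (exit_const * E))
      \<le> 1 - stay B ((1 + j * s) + s) w"
    proof (rule exit_prob_stage[OF m, where c = "g (J - j)"])
      show "gdist (g (J - Suc j)) (g (J - j)) = 80 * m" using g[of "J - Suc j"] Suc.prems J by simp
      show "(1 / (2 * hit_const)) ^ j \<le> 1" using K by (intro power_le_one) auto
      show "(1 / (2 * hit_const)) ^ j *
          (1 - occ (gball (g (J - j)) (200 * real m)) (\<lambda>_. 1) a / (exit_const * E)) \<le> 1 - stay B (1 + j * s) a"
        if "gdist (g (J - j)) a \<le> 16 * m" for a
        using Suc.IH[of a] Suc.prems that by simp
    qed (use Suc.prems E E200 s K in auto)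
    then show ?case by (simp add: algebra_simps)
  qed
  from this[of J "g 0"] have "(1 / (2 * hit_const)) ^ J *
      (1 - occ (gball (g 0) (200 * real m)) (\<lambda>_. 1) (g 0) / (exit_const * E)) \<le> 1 - stay B (1 + J * s) (g 0)"
    by simp
  \<comment> \<open>At the centre of the first ball the correction is small, because
    \<open>exit_const \<ge> 4\<close>.\<close>
  moreover have "occ (gball (g 0) (200 * real m)) (\<lambda>_. 1) (g 0) / (exit_const * E) \<le> 1 / 2"
  proof -
    have "occ (gball (g 0) (200 * real m)) (\<lambda>_. 1) (g 0) * 2 \<le> exit_const * E"
      using E200[of 0] mult_right_mono[of 2 exit_const E] M E1 by linarith
    then show ?thesis using M E1 by (simp add: field_simps)
  qed
  then have "(1 / (2 * hit_const)) ^ J * (1 / 2) \<le> (1 / (2 * hit_const)) ^ J *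
      (1 - occ (gball (g 0) (200 * real m)) (\<lambda>_. 1) (g 0) / (exit_const * E))"
    using K by (intro mult_left_mono) auto
  ultimately show ?thesis by linarith
qed

text \<open>At most \<open>5 * l\<close> stages, each of at most
  \<open>(2 * hit_const * exit_const + 1) * E\<close> steps with
  \<open>E = n / (Q_const * l)\<close>, then take at most \<open>n / 2\<close> steps.\<close>

definition Q_const :: real where "Q_const = 10 * (2 * hit_const * exit_const + 1)"

lemma Q_const_pos: "0 < Q_const"
proof -
  have "0 \<le> hit_const * exit_const"
    using hit_const_ge_1 exit_const_ge_4 by (intro mult_nonneg_nonneg) linarith+
  moreover have "0 < 10 * (2 * a + 1)" if "0 \<le> a" for a :: real using that by simp
  ultimately have "0 < 10 * (2 * (hit_const * exit_const) + 1)" by blast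
  then show ?thesis by (simp only: Q_const_def mult.assoc)
qed

lemma exit_prob_ge_l:
  assumes R: "0 < R" and y: "real (gdist x y) = 2 * R" and n: "\<lceil>R\<rceil> < int n"
    and l: "l_admissible Q_const 9 x y n R l" and large: "100 * real l < R"
  shows "(1 / 2) * exp (- (5 * ln (2 * hit_const)) * real l) \<le> 1 - stay (gball x R) n x"
proof -
  \<comment> \<open>\<open>m\<close> is at least \<open>1\<close> because \<open>r > 100\<close>,
    and \<open>J\<close> is the least number of strides of length \<open>80 * m\<close> that puts
    the last centre at distance at least \<open>R + 16 * m\<close>.\<close>
  define r where "r = R / real l"
  define m where "m = nat \<lfloor>r / 100\<rfloor>"
  define E where "E = real n / (Q_const * real l)"
  define J where "J = nat \<lceil>(R + 16 * real m) / (80 * real m)\<rceil>"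
  define s where "s = nat \<lceil>2 * hit_const * exit_const * E\<rceil>"
  have K: "1 \<le> hit_const" and M: "4 \<le> exit_const" by (rule hit_const_ge_1 exit_const_ge_4)+
  have KM: "0 \<le> 2 * hit_const * exit_const" using K M by simp
  note Q = Q_const_pos
  have l1: "1 \<le> real l" using l by (simp add: l_admissible_def)
  have r: "100 < r" "R = r * real l" unfolding r_def using large l1 by (auto simp: field_simps)
  have m: "1 \<le> m" "100 * real m \<le> r" "r \<le> 200 * real m"
  proof -
    have "real m = of_int \<lfloor>r / 100\<rfloor>" "1 \<le> \<lfloor>r / 100\<rfloor>" unfolding m_def using r by auto
    then show "100 * real m \<le> r" "1 \<le> m" "r \<le> 200 * real m" by linarith+
  qed
  have rR: "r \<le> R" using mult_left_mono[OF l1, of r] r by linarith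
  have J: "R + 16 * real m \<le> 80 * real m * real J" "80 * real m * real J \<le> R + 96 * real m"
  proof -
    have "0 \<le> (R + 16 * real m) / (80 * real m)" using R by simp
    then have "(R + 16 * real m) / (80 * real m) \<le> real J" "real J \<le> (R + 16 * real m) / (80 * real m) + 1"
      unfolding J_def by linarith+
    then show "R + 16 * real m \<le> 80 * real m * real J" "80 * real m * real J \<le> R + 96 * real m"
      using m(1) by (auto simp: field_simps)
  qed
  \<comment> \<open>The overshoot is at most \<open>96 * m \<le> r \<le> R\<close>, so all centres
    lie on the geodesic, whose length is \<open>2 * R\<close>.\<close>
  have J2: "80 * real m * real J \<le> 2 * R" using J(2) m(2) rR by linarith
  \<comment> \<open>The factor \<open>5\<close> is \<open>2 * 200 / 80\<close>, from
    \<open>R \<le> 200 * m * l\<close>.\<close>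
  have Jl: "real J \<le> 5 * real l"
  proof -
    have "80 * real m * real J \<le> 2 * (200 * real m * real l)"
      using J2 r(2) mult_right_mono[OF m(3), of "real l"] l1 by linarith
    then have "real J * real m \<le> 5 * real l * real m" by simp
    then show ?thesis using m(1) by (auto dest: mult_right_le_imp_le)
  qed
  have hull: "occ (gball z (9 * R / real l)) (\<lambda>_. 1) z \<le> E" if "z \<in> geodesic_hull x y" for z
  proof -
    have "mean_exit z (9 * R / real l) \<le> Max ((\<lambda>z. mean_exit z (9 * R / real l)) ` geodesic_hull x y)"
      using that finite_geodesic_hull by (intro Max_ge) auto
    then have "ennreal Q_const * mean_exit z (9 * R / real l) \<le>
        ennreal Q_const * Max ((\<lambda>z. mean_exit z (9 * R / real l)) ` geodesic_hull x y)"
      by (rule mult_left_mono) simp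
    also have "\<dots> \<le> ennreal (real n / real l)" using l by (simp add: l_admissible_def)
    finally have "Q_const * occ (gball z (9 * R / real l)) (\<lambda>_. 1) z \<le> real n / real l"
      using Q by (simp add: mean_exit_eq ennreal_mult'[symmetric])
    then show ?thesis using Q l1 by (simp add: E_def field_simps)
  qed
  obtain f where f: "f 0 = x" "\<And>i. i < gdist x y \<Longrightarrow> adj (f i) (f (Suc i))"
    "\<And>i. i \<le> gdist x y \<Longrightarrow> gdist x (f i) = i" "\<And>i. i \<le> gdist x y \<Longrightarrow> f i \<in> geodesic_hull x y"
    using geodesic[of x y] by metis
  define g where "g i = f (80 * m * i)" for i
  have le: "80 * m * i \<le> gdist x y" if "i \<le> J" for i
  proof -
    have "80 * m * i \<le> 80 * m * J" using that by simp
    moreover have "real (80 * m * J) \<le> real (gdist x y)" using J2 y by simp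
    ultimately show ?thesis by linarith
  qed
  have E: "occ (gball (g i) (300 * real m)) (\<lambda>_. 1) (g i) \<le> E" if "i \<le> J" for i
  proof -
    have "9 * R / real l = 9 * r" by (simp add: r_def)
    then have "300 * real m \<le> 9 * R / real l" using m(2) r(1) by linarith
    then have "occ (gball (g i) (300 * real m)) (\<lambda>_. 1) (g i) \<le> occ (gball (g i) (9 * R / real l)) (\<lambda>_. 1) (g i)"
      by (intro occ_mono finite_gball) (auto simp: gball_def)
    also have "\<dots> \<le> E" using f(4)[OF le[OF that]] by (intro hull) (simp add: g_def)
    finally show ?thesis .
  qed
  have "1 \<le> occ (gball (g 0) (300 * real m)) (\<lambda>_. 1) (g 0)"
    using m by (intro occ_ge_1 finite_gball) (simp add: gball_def)
  then have E1: "1 \<le> E" using E[of 0] by simp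
  have s: "2 * hit_const * exit_const * E \<le> real s" "real s \<le> (2 * hit_const * exit_const + 1) * E"
  proof -
    have "0 \<le> 2 * hit_const * exit_const * E" using KM E1 by simp
    then have "2 * hit_const * exit_const * E \<le> real s" "real s \<le> 2 * hit_const * exit_const * E + 1"
      unfolding s_def by linarith+
    then show "2 * hit_const * exit_const * E \<le> real s" "real s \<le> (2 * hit_const * exit_const + 1) * E"
      using E1 by (auto simp: algebra_simps)
  qed
  have time: "1 + J * s \<le> n"
  proof -
    have "real J * real s \<le> (5 * real l) * ((2 * hit_const * exit_const + 1) * E)"
      using Jl s(2) l1 by (intro mult_mono) auto
    also have "\<dots> = (Q_const / 2) * real l * E" by (simp add: Q_const_def)
    also have "\<dots> = real n / 2" using Q l1 by (simp add: E_def)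
    finally have "real (J * s) \<le> real n / 2" by simp
    \<comment> \<open>With \<open>n \<ge> 2\<close> the extra time unit fits into the other half of
      \<open>n\<close>.\<close>
    moreover have "1 < n" using n R by linarith
    ultimately show ?thesis by linarith
  qed
  have "(1 / (2 * hit_const)) ^ J / 2 \<le> 1 - stay (gball x R) (1 + J * s) (g 0)"
  proof (rule exit_prob_chain[OF _ _ E s(1)])
    show "0 < m" using m(1) by simp
    show "gdist (g i) (g (Suc i)) = 80 * m" if "i < J" for i
    proof -
      have l: "80 * m * Suc i \<le> gdist x y" "80 * m * i \<le> gdist x y" using le[of i] le[of "Suc i"] that by auto
      have "gdist (g i) (g (Suc i)) \<le> 80 * m * Suc i - 80 * m * i"
        unfolding g_def using f(2) l by (intro gdist_path[of "gdist x y"]) auto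
      moreover have "80 * m * Suc i \<le> 80 * m * i + gdist (g i) (g (Suc i))"
        using gdist_triangle[of x "g (Suc i)" "g i"] f(3)[OF l(1)] f(3)[OF l(2)] by (simp add: g_def)
      ultimately show ?thesis by simp
    qed
    show "a \<notin> gball x R" if "gdist (g J) a \<le> 16 * m" for a
    proof -
      have "80 * m * J \<le> gdist x a + 16 * m"
        using gdist_triangle[of x "g J" a] f(3)[OF le[of J]] that gdist_sym[of a "g J"] by (simp add: g_def)
      then have "real (80 * m * J) \<le> real (gdist x a + 16 * m)" by (rule of_nat_mono)
      then show ?thesis using J(1) by (simp add: gball_def)
    qed
  qed
  also have "\<dots> \<le> 1 - stay (gball x R) n x"
    using stay_antimono[OF time] f(1) by (simp add: g_def)
  finally have *: "(1 / (2 * hit_const)) ^ J / 2 \<le> 1 - stay (gball x R) n x" .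
  have "exp (- (5 * ln (2 * hit_const)) * real l) \<le> exp (real J * - ln (2 * hit_const))"
    using mult_right_mono[OF Jl, of "ln (2 * hit_const)"] K by (simp add: algebra_simps)
  also have "\<dots> = exp (- ln (2 * hit_const)) ^ J" by (rule exp_of_nat_mult)
  also have "exp (- ln (2 * hit_const)) = 1 / (2 * hit_const)" using K by (simp add: exp_minus inverse_eq_divide)
  finally show ?thesis using * by simp
qed

text \<open>Two regimes. If \<open>\<nu> \<ge> R / 100\<close>, walking straight out suffices;
  otherwise \<open>\<nu>\<close> is an admissible \<open>l\<close> with \<open>100 * l < R\<close>,
  and the chain of balls applies.\<close>

lemma exit_prob_lower:
  assumes R: "0 < R" and sphere: "gsphere x (2 * R) \<noteq> {}" and n: "\<lceil>R\<rceil> < int n"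
  shows "min p\<^sub>0 (1 / 2) * exp (- (max (- 100 * ln p\<^sub>0) (5 * ln (2 * hit_const))) * nu_exponent Q_const x n R)
    \<le> 1 - stay (gball x R) n x"
proof -
  let ?l = "\<lambda>y. l_exponent Q_const 9 x y n R"
  define \<nu> where "\<nu> = nu_exponent Q_const x n R"
  define A where "A = max (- 100 * ln p\<^sub>0) (5 * ln (2 * hit_const))"
  have "\<nu> \<in> ?l ` gsphere x (2 * R)"
    unfolding \<nu>_def nu_exponent_def using sphere finite_gsphere by (intro Min_in) auto
  then obtain y where y: "real (gdist x y) = 2 * R" "\<nu> = ?l y" by (auto simp: gsphere_def)
  have A: "- 100 * ln p\<^sub>0 \<le> A" "5 * ln (2 * hit_const) \<le> A" by (simp_all add: A_def)
  have \<nu>0: "0 \<le> \<nu>" unfolding y(2) l_exponent_def using R by simp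
  show ?thesis
  proof (cases "R \<le> 100 * \<nu>")
    case True
    have "min p\<^sub>0 (1 / 2) * exp (- A * \<nu>) \<le> p\<^sub>0 * exp (- (- 100 * ln p\<^sub>0) * \<nu>)"
      using mult_right_mono[OF A(1) \<nu>0] p0_pos by (intro mult_mono) auto
    also have "\<dots> = exp ((100 * \<nu> + 1) * ln p\<^sub>0)"
      using p0_pos by (simp add: exp_add algebra_simps)
    \<comment> \<open>Rounding \<open>R\<close> up is paid for by the factor
      \<open>p\<^sub>0\<close> in front.\<close>
    also have "\<dots> \<le> exp (real (nat \<lceil>R\<rceil>) * ln p\<^sub>0)"
    proof -
      have "real (nat \<lceil>R\<rceil>) \<le> 100 * \<nu> + 1" using True R by linarith
      then show ?thesis using p0_pos p0_le_1 by (simp add: mult_right_mono_neg)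
    qed
    also have "\<dots> = p\<^sub>0 ^ nat \<lceil>R\<rceil>" using p0_pos by (simp only: exp_of_nat_mult exp_ln)
    also have "\<dots> \<le> 1 - stay (gball x R) n x" by (rule exit_prob_ge_power[OF R y(1) n])
    finally show ?thesis by (simp add: A_def \<nu>_def)
  next
    case False
    \<comment> \<open>The default value \<open>R\<close> of \<open>l_exponent\<close> would
      contradict \<open>R > 100 * \<nu>\<close>.\<close>
    have "\<exists>l. l_admissible Q_const 9 x y n R l"
    proof (rule ccontr)
      assume "\<not> ?thesis"
      then have "\<nu> = R" by (simp add: y(2) l_exponent_def)
      then show False using False R by simp
    qed
    then obtain l where l: "l_admissible Q_const 9 x y n R l" "\<nu> = real l"
      unfolding y(2) l_exponent_def using LeastI_ex by (metis (no_types, lifting))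
    have "min p\<^sub>0 (1 / 2) * exp (- A * \<nu>) \<le> (1 / 2) * exp (- (5 * ln (2 * hit_const)) * \<nu>)"
      using mult_right_mono[OF A(2) \<nu>0] p0_pos by (intro mult_mono) auto
    also have "\<dots> \<le> 1 - stay (gball x R) n x"
      unfolding l(2) using False l by (intro exit_prob_ge_l[OF R y(1) n]) auto
    finally show ?thesis by (simp add: A_def \<nu>_def)
  qed
qed

end

section \<open>Assembling the two bounds\<close>

context p0_graph
begin

text \<open>Balls are finite, so maximum and minimum give pointwise bounds; \<open>max 1 C\<close>
  makes the powers of the constant increasing.\<close>

lemma elliptic_harnack_graph:
  assumes elliptic_harnack
  obtains C where "harnack_graph adj \<mu> p\<^sub>0 C"
proof -
  obtain C where C: "C > 0" "\<And>x R u. R > 0 \<Longrightarrow>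
        (\<forall>y \<in> gball x (2 * R) \<union> outer_boundary (gball x (2 * R)). 0 \<le> u y) \<Longrightarrow>
        harmonic_on u (gball x (2 * R)) \<Longrightarrow> Max (u ` gball x R) \<le> C * Min (u ` gball x R)"
    using assms by (auto simp: elliptic_harnack_def)
  have "harnack_graph adj \<mu> p\<^sub>0 (max 1 C)"
  proof
    fix R :: real and u :: "'a \<Rightarrow> real" and x y z :: 'a
    assume R: "0 < R" and u: "\<And>v. 0 \<le> u v" and harm: "\<And>v. v \<in> gball x (2 * R) \<Longrightarrow> avg u v = u v"
      and yz: "y \<in> gball x R" "z \<in> gball x R"
    have "u y \<le> Max (u ` gball x R)" using yz by simp
    also have "\<dots> \<le> C * Min (u ` gball x R)"
      using R u harm by (intro C(2)) (auto simp: harmonic_on_iff)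
    also have "\<dots> \<le> C * u z" using yz C(1) by (intro mult_left_mono) auto
    also have "\<dots> \<le> max 1 C * u z" using u by (intro mult_right_mono) auto
    finally show "u y \<le> max 1 C * u z" .
  qed simp
  then show ?thesis using that by blast
qed

end

theorem theorem23:
  fixes adj :: "'a \<Rightarrow> 'a \<Rightarrow> bool" and \<mu> :: "'a \<Rightarrow> 'a \<Rightarrow> real"
  assumes graph: "weighted_graph adj \<mu>"
    and p0: "weighted_graph.cond_p0 adj \<mu>"
  shows
    "(weighted_graph.cond_Ebar adj \<mu> \<longrightarrow>
       (\<exists>q>0. \<exists>c>0. \<exists>C>0. \<forall>(x::'a) (n::nat) (R::real).
          0 < R \<longrightarrow> R \<le> real n \<longrightarrow>
          \<P>(\<omega> in weighted_graph.walk adj \<mu> x.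
              weighted_graph.exit_time (weighted_graph.gball adj x R) \<omega> < enat n)
            \<le> C * exp (- c * real (weighted_graph.k_exponent adj \<mu> q x n R)))) \<and>
     (weighted_graph.elliptic_harnack adj \<mu> \<longrightarrow>
       (\<exists>Q>0. \<exists>c>0. \<exists>C>0. \<forall>(x::'a) (n::nat) (R::real).
          0 < R \<longrightarrow> weighted_graph.gsphere adj x (2 * R) \<noteq> {} \<longrightarrow> \<lceil>R\<rceil> < int n \<longrightarrow>
          \<P>(\<omega> in weighted_graph.walk adj \<mu> x.
              weighted_graph.exit_time (weighted_graph.gball adj x R) \<omega> < enat n)
            \<ge> c * exp (- C * weighted_graph.nu_exponent adj \<mu> Q x n R)))"
proof -
  interpret weighted_graph adj \<mu> by (rule graph)
  obtain p\<^sub>0 where "0 < p\<^sub>0" "\<And>x y. adj x y \<Longrightarrow> p\<^sub>0 \<le> trans_prob x y"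
    using p0 by (auto simp: cond_p0_def)
  then interpret p0_graph adj \<mu> p\<^sub>0 by unfold_locales
  show ?thesis
  proof (intro conjI impI)
    assume cond_Ebar
    then obtain C where C: "1 \<le> C"
      "\<And>x R v. 0 < R \<Longrightarrow> v \<in> gball x R \<Longrightarrow>
        occ (gball x R) (\<lambda>_. 1) v \<le> C * occ (gball x R) (\<lambda>_. 1) x"
      by (rule cond_Ebar_occ) (rule that)
    show "\<exists>q>0. \<exists>c>0. \<exists>C>0. \<forall>x n R. 0 < R \<longrightarrow> R \<le> real n \<longrightarrow>
        \<P>(\<omega> in walk x. exit_time (gball x R) \<omega> < enat n) \<le> C * exp (- c * real (k_exponent q x n R))"
    proof (intro exI conjI allI impI)
      show "\<P>(\<omega> in walk x. exit_time (gball x R) \<omega> < enat n)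
          \<le> exp (1 / (2 * C)) * exp (- (1 / (8 * C)) * real (k_exponent (1 / 8) x n R))"
        if "0 < R" for x n R
        unfolding prob_exit_time_less[OF finite_gball] using C that by (rule exit_prob_upper)
    qed (use C in auto)
  next
    assume elliptic_harnack
    then obtain C where "harnack_graph adj \<mu> p\<^sub>0 C" by (rule elliptic_harnack_graph)
    then interpret harnack_graph adj \<mu> p\<^sub>0 C .
    show "\<exists>Q>0. \<exists>c>0. \<exists>C>0. \<forall>x n R. 0 < R \<longrightarrow> gsphere x (2 * R) \<noteq> {} \<longrightarrow> \<lceil>R\<rceil> < int n \<longrightarrow>
        c * exp (- C * nu_exponent Q x n R) \<le> \<P>(\<omega> in walk x. exit_time (gball x R) \<omega> < enat n)"
    proof (intro exI conjI allI impI)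
      show "min p\<^sub>0 (1 / 2) *
          exp (- (max (- 100 * ln p\<^sub>0) (5 * ln (2 * hit_const))) * nu_exponent Q_const x n R)
          \<le> \<P>(\<omega> in walk x. exit_time (gball x R) \<omega> < enat n)"
        if "0 < R" "gsphere x (2 * R) \<noteq> {}" "\<lceil>R\<rceil> < int n" for x n R
        unfolding prob_exit_time_less[OF finite_gball] using that by (rule exit_prob_lower)
    \<comment> \<open>The constant in the exponent is positive because
      \<open>2 * hit_const > 1\<close>.\<close>
    qed (use Q_const_pos p0_pos hit_const_ge_1 in \<open>auto simp: less_max_iff_disj\<close>)
  qed
qed

end
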